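(* Let $\mathcal{A}$ be a finite alphabet and let $X\subset\mathcal{A}^{\mathbb{Z}}$ be a subshift whose complexity function satisfies $P_X(n)=o(n^2/\log^2 n)$ as $n\to\infty$. Then the group $\operatorname{Aut}(X)$ is amenable as a countable discrete group.
   Context: $\mathcal{A}^{\mathbb{Z}}$ carries the product topology (with $\mathcal{A}$ discrete), and $\sigma:\mathcal{A}^{\mathbb{Z}}\to\mathcal{A}^{\mathbb{Z}}$ is the left shift, $(\sigma x)_i=x_{i+1}$. A subshift is a closed, $\sigma$-invariant set $X\subset\mathcal{A}^{\mathbb{Z}}$ (with $\sigma X=X$), together with $\sigma|_X$. A word $w=(w_0,\dots,w_{n-1})\in\mathcal{A}^n$ belongs to $\mathcal{L}_n(X)$ if there is $x\in X$ with $x_i=w_i$ for $0\le i<n$. The complexity function is $P_X(n)=|\mathcal{L}_n(X)|$. $\operatorname{Aut}(X)$ is the group, under composition, of all homeomorphisms $\phi:X\to X$ with $\phi\circ\sigma=\sigma\circ\phi$; it is a countable group. *)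

theory Defs
  imports
    "HOL-Algebra.Bij"
    "HOL-Algebra.Coset"
    "HOL-Analysis.Function_Topology"
    "HOL-Library.Landau_Symbols"
begin

definition full_shift :: "'a set \<Rightarrow> (int \<Rightarrow> 'a) topology" where
  "full_shift A = product_topology (\<lambda>_. discrete_topology A) UNIV"

definition shift :: "(int \<Rightarrow> 'a) \<Rightarrow> int \<Rightarrow> 'a" where
  "shift x = (\<lambda>i. x (i + 1))"

definition subshift :: "'a set \<Rightarrow> (int \<Rightarrow> 'a) set \<Rightarrow> bool" where
  "subshift A X \<longleftrightarrow> closedin (full_shift A) X \<and> shift ` X = X"

definition language :: "(int \<Rightarrow> 'a) set \<Rightarrow> nat \<Rightarrow> 'a list set" where
  "language X n = {w. length w = n \<and> (\<exists>x\<in>X. \<forall>i<n. x (int i) = w ! i)}"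

definition complexity :: "(int \<Rightarrow> 'a) set \<Rightarrow> nat \<Rightarrow> nat" where
  "complexity X n = card (language X n)"

text \<open>Maps on \<open>X\<close> are represented by functions that are \<open>undefined\<close> outside
  \<open>X\<close>, so that equality of group elements is equality of maps on \<open>X\<close>.\<close>

definition shift_Aut ::
  "'a set \<Rightarrow> (int \<Rightarrow> 'a) set \<Rightarrow> ((int \<Rightarrow> 'a) \<Rightarrow> int \<Rightarrow> 'a) monoid" where
  "shift_Aut A X = BijGroup X \<lparr>carrier := {\<phi> \<in> Bij X.
     homeomorphic_map (subtopology (full_shift A) X) (subtopology (full_shift A) X) \<phi> \<and>
     (\<forall>x\<in>X. \<phi> (shift x) = shift (\<phi> x))}\<rparr>"

text \<open>Amenability of a discrete group: there is a left-invariant finitely additive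
  probability measure on the power set of the group.\<close>

definition amenable :: "('g, 'm) monoid_scheme \<Rightarrow> bool" where
  "amenable G \<longleftrightarrow> group G \<and>
     (\<exists>\<mu> :: 'g set \<Rightarrow> real.
        (\<forall>S. S \<subseteq> carrier G \<longrightarrow> 0 \<le> \<mu> S) \<and>
        \<mu> (carrier G) = 1 \<and>
        (\<forall>S T. S \<subseteq> carrier G \<and> T \<subseteq> carrier G \<and> S \<inter> T = {} \<longrightarrow> \<mu> (S \<union> T) = \<mu> S + \<mu> T) \<and>
        (\<forall>g\<in>carrier G. \<forall>S. S \<subseteq> carrier G \<longrightarrow> \<mu> (g <#\<^bsub>G\<^esub> S) = \<mu> S))"

lemma topspace_full_shift: "topspace (full_shift A) = {x. range x \<subseteq> A}"
  by (auto simp: full_shift_def PiE_def Pi_def)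

lemma subgroup_shift_Aut:
  assumes "subshift A X"
  shows "subgroup (carrier (shift_Aut A X)) (BijGroup X)"
proof -
  let ?T = "subtopology (full_shift A) X"
  have top: "topspace ?T = X"
    using assms closedin_subset by (auto simp: subshift_def topspace_subtopology)
  have sh: "shift x \<in> X" if "x \<in> X" for x
    using assms that by (auto simp: subshift_def)
  interpret group "BijGroup X" by (rule group_BijGroup)
  show ?thesis
  proof (rule subgroupI)
    show "carrier (shift_Aut A X) \<subseteq> carrier (BijGroup X)"
      by (auto simp: shift_Aut_def BijGroup_def)
    have "homeomorphic_map ?T ?T (\<lambda>x\<in>X. x)"
      using homeomorphic_map_eq[of ?T ?T id "\<lambda>x\<in>X. x"] top by (auto simp: homeomorphic_map_id)
    then have "(\<lambda>x\<in>X. x) \<in> carrier (shift_Aut A X)"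
      by (auto simp: shift_Aut_def id_Bij sh)
    then show "carrier (shift_Aut A X) \<noteq> {}" by blast
  next
    fix f assume "f \<in> carrier (shift_Aut A X)"
    then have f: "f \<in> Bij X" "homeomorphic_map ?T ?T f" "\<And>x. x \<in> X \<Longrightarrow> f (shift x) = shift (f x)"
      by (auto simp: shift_Aut_def)
    have bij: "bij_betw f X X" using f(1) by (auto simp: Bij_def)
    obtain g where g: "homeomorphic_maps ?T ?T f g"
      using f(2) homeomorphic_map_maps by blast
    have gX: "g x \<in> X" and fg: "f (g x) = x" and gf: "g (f x) = x" if "x \<in> X" for x
      using g that top by (auto simp: homeomorphic_maps_def continuous_map_def Pi_iff)
    have eq: "inv_into X f x = g x" if "x \<in> X" for x
      using bij that gX fg by (metis bij_betw_imp_inj_on inv_into_f_f)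
    have hg: "homeomorphic_map ?T ?T g"
      using g homeomorphic_map_maps homeomorphic_maps_sym by blast
    have "homeomorphic_map ?T ?T (\<lambda>x\<in>X. inv_into X f x)"
      by (rule homeomorphic_map_eq[OF hg]) (use top eq in auto)
    moreover have "g (shift x) = shift (g x)" if "x \<in> X" for x
      using f(3)[OF gX[OF that]] fg gf gX sh that by metis
    ultimately have "(\<lambda>x\<in>X. inv_into X f x) \<in> carrier (shift_Aut A X)"
      using f(1) by (auto simp: shift_Aut_def restrict_inv_into_Bij eq sh)
    then show "inv\<^bsub>BijGroup X\<^esub> f \<in> carrier (shift_Aut A X)"
      using f(1) by (simp add: inv_BijGroup)
  next
    fix f g assume "f \<in> carrier (shift_Aut A X)" "g \<in> carrier (shift_Aut A X)"
    then have f: "f \<in> Bij X" "homeomorphic_map ?T ?T f" "\<And>x. x \<in> X \<Longrightarrow> f (shift x) = shift (f x)"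
      and g: "g \<in> Bij X" "homeomorphic_map ?T ?T g" "\<And>x. x \<in> X \<Longrightarrow> g (shift x) = shift (g x)"
      by (auto simp: shift_Aut_def)
    have gX: "g x \<in> X" if "x \<in> X" for x
      using g(1) that by (auto simp: Bij_def bij_betw_def)
    have "homeomorphic_map ?T ?T (compose X f g)"
      by (rule homeomorphic_map_eq[OF homeomorphic_map_compose[OF g(2) f(2)]])
         (use top in \<open>auto simp: compose_def\<close>)
    then show "f \<otimes>\<^bsub>BijGroup X\<^esub> g \<in> carrier (shift_Aut A X)"
      using f g gX sh by (auto simp: shift_Aut_def BijGroup_def compose_Bij compose_eq)
  qed
qed

lemma group_shift_Aut:
  assumes "subshift A X"
  shows "group (shift_Aut A X)"
proof -
  have "shift_Aut A X = BijGroup X \<lparr>carrier := carrier (shift_Aut A X)\<rparr>"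
    by (simp add: shift_Aut_def)
  then show ?thesis
    using subgroup.subgroup_is_group[OF subgroup_shift_Aut[OF assms] group_BijGroup] by simp
qed

end

theory Submission
  imports Defs "HOL-Analysis.Harmonic_Numbers" "HOL-Real_Asymp.Real_Asymp"
begin

text \<open>The growth of finitely generated subgroups of the automorphism group is subexponential, which
  yields Folner sets. Let \<open>P\<close> be the complexity and let \<open>g\<close> be a product of \<open>n\<close> automorphisms of range
  \<open>R\<close>, so that \<open>g\<close> has range \<open>n * R\<close>; take \<open>M\<close> slightly larger than \<open>2 * n * R\<close>. In the Rauzy graph of
  words of length \<open>M\<close>, a word is reached from an extension of a right special word along a forced
  path, or it lies on a cycle without right special words. Hence all words of length \<open>M\<close> occur in few
  words \<open>u\<close> of length \<open>M + P M\<close>: there are at most \<open>2 * (P (M + 1) - P M)\<close> of the first kind, and the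
  cycles of the second kind are periodic orbits, of which there are at most \<open>P (4 * k) / k\<close> with
  least period in \<open>[k, 2 * k)\<close>, and at most \<open>P M / k\<close> with least period at least \<open>k\<close>. For suitable
  \<open>M\<close> this makes the number of words \<open>u\<close> of order \<open>o(M / ln M)\<close>. The map \<open>g\<close> is determined by
  its values on the \<open>u\<close>, each of which takes polynomially many values, so there are only
  \<open>exp (o(n))\<close> such \<open>g\<close>.\<close>

section \<open>Amenability from subexponential growth\<close>

text \<open>Compactness replaces a limit along Folner sets. In the compact space of functions from
  sets to \<open>[0, 1]\<close>, additivity and each approximate invariance condition are closed,
  and any finitely many of them hold for the normalised counting measure of one sufficiently
  invariant finite set. A point common to all of them is the measure.\<close>

lemma amenable_if_Folner:
  fixes G (structure)
  assumes "group G"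
    and Folner: "\<And>F e. \<lbrakk>finite F; F \<subseteq> carrier G; e > (0::real)\<rbrakk> \<Longrightarrow>
      \<exists>E. finite E \<and> E \<noteq> {} \<and> E \<subseteq> carrier G \<and>
          (\<forall>g\<in>F. real (card ((g <#\<^bsub>G\<^esub> E) - E)) \<le> e * real (card E))"
  shows "amenable G"
proof -
  interpret group G by fact
  define I where "I = (UNIV :: 'a set set) \<rightarrow>\<^sub>E {0..1::real}"
  have coord: "continuous_on UNIV (\<lambda>m. m S)" for S :: "'a set"
    by (rule continuous_on_product_coordinates)
  have "compact I"
  proof -
    have "compactin (product_topology (\<lambda>_. euclidean) UNIV) I"
      unfolding I_def compactin_PiE by simp
    then show ?thesis
      by (simp only: euclidean_product_topology compactin_euclidean_iff)
  qed
  define Add where "Add = {m :: 'a set \<Rightarrow> real. m (carrier G) = 1 \<and>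
    (\<forall>S T. S \<subseteq> carrier G \<and> T \<subseteq> carrier G \<and> S \<inter> T = {} \<longrightarrow> m (S \<union> T) = m S + m T)}"
  \<comment> \<open>Only one inequality is imposed, since applying it to the inverse element yields
    the other; a counting measure satisfies it up to the slack \<open>1 / (k + 1)\<close>.\<close>
  define Inv where "Inv = (\<lambda>(g, k::nat). {m :: 'a set \<Rightarrow> real.
    \<forall>S. S \<subseteq> carrier G \<longrightarrow> m S \<le> m (g <#\<^bsub>G\<^esub> S) + inverse (real (Suc k))})"
  have closed_Add: "closed Add"
    unfolding Add_def by (intro closed_Collect_conj closed_Collect_all closed_Collect_imp
        closed_Collect_eq continuous_intros coord open_Collect_const)
  have closed_Inv: "closed (Inv i)" for i
    unfolding Inv_def case_prod_unfold by (intro closed_Collect_all closed_Collect_imp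
        closed_Collect_le continuous_intros coord open_Collect_const)
  have fip: "I \<inter> \<Inter>\<F> \<noteq> {}"
    if "finite \<F>" "\<F> \<subseteq> insert Add (Inv ` (carrier G \<times> UNIV))" for \<F>
  proof -
    have "finite (\<F> - {Add})" "\<F> - {Add} \<subseteq> Inv ` (carrier G \<times> UNIV)"
      using that by auto
    from finite_subset_image[OF this]
    obtain J where J: "finite J" "J \<subseteq> carrier G \<times> UNIV" "\<F> - {Add} = Inv ` J"
      by metis
    \<comment> \<open>The largest index gives the smallest slack, so one Folner set serves the whole
      finite family.\<close>
    define K where "K = Max (insert 0 (snd ` J))"
    have K: "snd i \<le> K" if "i \<in> J" for i
      unfolding K_def using J(1) that by (intro Max_ge) auto
    obtain E where E: "finite E" "E \<noteq> {}" "E \<subseteq> carrier G"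
      and E_inv: "\<And>g. g \<in> fst ` J \<Longrightarrow> real (card ((g <#\<^bsub>G\<^esub> E) - E)) \<le> inverse (real (Suc K)) * real (card E)"
    proof -
      have "finite (fst ` J)" "fst ` J \<subseteq> carrier G" "inverse (real (Suc K)) > 0"
        using J(1,2) by auto
      from Folner[OF this] show ?thesis using that by blast
    qed
    define m where "m = (\<lambda>S. real (card (E \<inter> S)) / real (card E))"
    have cE: "real (card E) > 0" using E by (simp add: card_gt_0_iff)
    have "m S \<le> 1" for S
      using E(1) cE by (simp add: m_def card_mono)
    then have "m \<in> I" by (auto simp: I_def m_def)
    moreover have "m \<in> Add"
    proof -
      have "card (E \<inter> (S \<union> T)) = card (E \<inter> S) + card (E \<inter> T)" if "S \<inter> T = {}" for S T
        unfolding Int_Un_distrib using E(1) that by (intro card_Un_disjoint) auto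
      then show ?thesis
        using cE E(3) by (auto simp: Add_def m_def add_divide_distrib Int_absorb2)
    qed
    moreover have "m \<in> Inv (g, k)" if gk: "(g, k) \<in> J" for g k
    proof -
      have g: "g \<in> carrier G" using gk J(2) by auto
      have "m S \<le> m (g <#\<^bsub>G\<^esub> S) + inverse (real (Suc k))" if S: "S \<subseteq> carrier G" for S
      proof -
        have inj: "inj_on (\<lambda>x. g \<otimes> x) (carrier G)"
          using g by (auto intro!: inj_onI)
        have "card (E \<inter> S) = card ((\<lambda>x. g \<otimes> x) ` (E \<inter> S))"
          using inj E(3) by (metis card_image inf.coboundedI1 inj_on_subset)
        \<comment> \<open>A translated point of \<open>E\<close> and \<open>S\<close> lies in the
          translate of \<open>S\<close>; it either stays in \<open>E\<close> or is among the points
          of the translate of \<open>E\<close> that leave \<open>E\<close>.\<close>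
        also have "\<dots> \<le> card ((E \<inter> (g <#\<^bsub>G\<^esub> S)) \<union> ((g <#\<^bsub>G\<^esub> E) - E))"
          using E(1) by (intro card_mono) (auto simp: l_coset_def)
        also have "\<dots> \<le> card (E \<inter> (g <#\<^bsub>G\<^esub> S)) + card ((g <#\<^bsub>G\<^esub> E) - E)"
          by (rule card_Un_le)
        finally have "card (E \<inter> S) \<le> card (E \<inter> (g <#\<^bsub>G\<^esub> S)) + card ((g <#\<^bsub>G\<^esub> E) - E)" .
        moreover have "real (card ((g <#\<^bsub>G\<^esub> E) - E)) \<le> inverse (real (Suc k)) * real (card E)"
        proof (rule order_trans)
          show "real (card ((g <#\<^bsub>G\<^esub> E) - E)) \<le> inverse (real (Suc K)) * real (card E)"
            using E_inv gk by (metis fst_conv image_eqI)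
          have "inverse (real (Suc K)) \<le> inverse (real (Suc k))"
            using K[OF gk] by (intro le_imp_inverse_le) auto
          then show "inverse (real (Suc K)) * real (card E) \<le> inverse (real (Suc k)) * real (card E)"
            by (rule mult_right_mono) simp
        qed
        ultimately have "real (card (E \<inter> S)) \<le> real (card (E \<inter> (g <#\<^bsub>G\<^esub> S))) +
            inverse (real (Suc k)) * real (card E)"
          by linarith
        from divide_right_mono[OF this, of "real (card E)"] show ?thesis
          by (simp only: m_def add_divide_distrib nonzero_mult_div_cancel_right
              less_imp_neq[OF cE, symmetric] not_False_eq_True)
      qed
      then show ?thesis by (simp add: Inv_def)
    qed
    then have "m \<in> \<Inter>(\<F> - {Add})" using J(3) by auto
    ultimately show ?thesis by blast
  qed
  have "I \<inter> \<Inter>(insert Add (Inv ` (carrier G \<times> UNIV))) \<noteq> {}"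
  proof (rule compact_imp_fip[OF \<open>compact I\<close> _ fip])
    show "closed T" if "T \<in> insert Add (Inv ` (carrier G \<times> UNIV))" for T
      using that closed_Add closed_Inv by blast
  qed
  then obtain m where m: "m \<in> I" "m \<in> Add"
    and inv: "\<And>g k. g \<in> carrier G \<Longrightarrow> m \<in> Inv (g, k)"
    by auto
  have le: "m S \<le> m (g <#\<^bsub>G\<^esub> S)" if "g \<in> carrier G" "S \<subseteq> carrier G" for g S
  proof (rule field_le_epsilon)
    fix e :: real assume "e > 0"
    then obtain k where "inverse (real (Suc k)) < e" using reals_Archimedean by blast
    moreover have "m S \<le> m (g <#\<^bsub>G\<^esub> S) + inverse (real (Suc k))"
      using inv[OF that(1), of k] that(2) unfolding Inv_def case_prod_conv mem_Collect_eq by blast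
    ultimately show "m S \<le> m (g <#\<^bsub>G\<^esub> S) + e" by linarith
  qed
  have m_inv: "m (g <#\<^bsub>G\<^esub> S) = m S" if g: "g \<in> carrier G" and S: "S \<subseteq> carrier G" for g S
  proof (rule antisym)
    have "m (g <#\<^bsub>G\<^esub> S) \<le> m (inv g <#\<^bsub>G\<^esub> (g <#\<^bsub>G\<^esub> S))"
      using g S by (intro le) (auto simp: l_coset_def)
    also have "inv g <#\<^bsub>G\<^esub> (g <#\<^bsub>G\<^esub> S) = S"
      using g S by (simp add: lcos_m_assoc lcos_mult_one)
    finally show "m (g <#\<^bsub>G\<^esub> S) \<le> m S" .
  qed (use le g S in auto)
  show ?thesis
    unfolding amenable_def
  proof (intro conjI exI[of _ m] allI ballI impI)
    show "0 \<le> m S" for S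
      using m(1) by (auto simp: I_def PiE_iff)
  qed (use m(2) m_inv \<open>group G\<close> in \<open>auto simp: Add_def\<close>)
qed

section \<open>Growth of product sets\<close>

fun set_pow :: "('g, 'm) monoid_scheme \<Rightarrow> 'g set \<Rightarrow> nat \<Rightarrow> 'g set" where
  "set_pow G S 0 = {\<one>\<^bsub>G\<^esub>}"
| "set_pow G S (Suc n) = S <#>\<^bsub>G\<^esub> set_pow G S n"

text \<open>If the product sets grew by more than the factor \<open>1 + e\<close> at every step,
  their sizes would be at least \<open>(1 + e) ^ n\<close> for all \<open>n\<close>. So some step
  has a smaller factor, and the product set before that step is a Folner set.\<close>

lemma amenable_if_subexponential_growth:
  fixes G (structure)
  assumes "group G"
    and growth: "\<And>S e. \<lbrakk>finite S; S \<subseteq> carrier G; e > (0::real)\<rbrakk> \<Longrightarrow>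
      \<exists>n. real (card (set_pow G S n)) < (1 + e) ^ n"
  shows "amenable G"
proof (rule amenable_if_Folner[OF \<open>group G\<close>])
  interpret group G by fact
  fix F and e :: real
  assume F: "finite F" "F \<subseteq> carrier G" and e: "e > 0"
  \<comment> \<open>With the identity included the product sets increase, so the points that leave
    \<open>B n\<close> are counted by a difference of two cardinalities.\<close>
  define S where "S = insert \<one> F"
  define B where "B = set_pow G S"
  have S: "finite S" "S \<subseteq> carrier G" using F by (auto simp: S_def)
  have B_Suc: "B (Suc n) = (\<Union>s\<in>S. s <#\<^bsub>G\<^esub> B n)" for n
    by (auto simp: B_def set_mult_def l_coset_def)
  have B: "finite (B n) \<and> B n \<noteq> {} \<and> B n \<subseteq> carrier G" for n
  proof (induction n)
    case (Suc n)
    then show ?case using S unfolding B_Suc by (auto simp: l_coset_def S_def)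
  qed (auto simp: B_def)
  have incr: "g <#\<^bsub>G\<^esub> B n \<subseteq> B (Suc n)" if "g \<in> S" for g n
    using that by (auto simp: B_Suc)
  have "\<exists>n. real (card (B (Suc n))) \<le> (1 + e) * real (card (B n))"
  proof (rule ccontr)
    assume "\<not> ?thesis"
    then have step: "(1 + e) * real (card (B n)) \<le> real (card (B (Suc n)))" for n
      by (meson linear)
    have "(1 + e) ^ n \<le> real (card (B n))" for n
    proof (induction n)
      case (Suc n)
      have "(1 + e) ^ Suc n \<le> (1 + e) * real (card (B n))"
        using Suc e by (simp add: mult_left_mono)
      then show ?case using step[of n] by linarith
    qed (simp add: B_def)
    then show False
      using growth[OF S e] unfolding B_def by (meson not_le)
  qed
  then obtain n where n: "real (card (B (Suc n))) \<le> (1 + e) * real (card (B n))" by blast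
  have sub: "B n \<subseteq> B (Suc n)"
    using incr[of \<one> n] B[of n] by (simp add: S_def lcos_mult_one)
  have "real (card ((g <#\<^bsub>G\<^esub> B n) - B n)) \<le> e * real (card (B n))" if "g \<in> F" for g
  proof -
    have "card ((g <#\<^bsub>G\<^esub> B n) - B n) \<le> card (B (Suc n) - B n)"
      using B[of "Suc n"] incr[of g n] that by (intro card_mono) (auto simp: S_def)
    also have "\<dots> = card (B (Suc n)) - card (B n)"
      using B[of n] sub by (simp add: card_Diff_subset)
    finally have "real (card ((g <#\<^bsub>G\<^esub> B n) - B n)) \<le> real (card (B (Suc n)) - card (B n))"
      by simp
    also have "\<dots> = real (card (B (Suc n))) - real (card (B n))"
      using B[of "Suc n"] sub by (simp add: card_mono of_nat_diff)
    finally show ?thesis using n by (simp add: algebra_simps)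
  qed
  then show "\<exists>E. finite E \<and> E \<noteq> {} \<and> E \<subseteq> carrier G \<and>
      (\<forall>g\<in>F. real (card ((g <#\<^bsub>G\<^esub> E) - E)) \<le> e * real (card E))"
    using B[of n] by blast
qed

section \<open>Words and right special words\<close>

definition translate :: "int \<Rightarrow> (int \<Rightarrow> 'a) \<Rightarrow> int \<Rightarrow> 'a" where
  "translate k x = (\<lambda>i. x (i + k))"

definition word :: "(int \<Rightarrow> 'a) \<Rightarrow> int \<Rightarrow> nat \<Rightarrow> 'a list" where
  "word x t n = map (\<lambda>i. x (t + int i)) [0..<n]"

lemma word_eq_iff: "word x s n = word y t n \<longleftrightarrow> (\<forall>i<n. x (s + int i) = y (t + int i))"
  by (auto simp: word_def)

lemma word_translate: "word (translate k x) t n = word x (t + k) n"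
  by (simp add: word_def translate_def algebra_simps)

lemma word_Suc_eq_iff:
  "word x s (Suc n) = word y t (Suc n) \<longleftrightarrow> word x s n = word y t n \<and> x (s + int n) = y (t + int n)"
  by (auto simp: word_eq_iff less_Suc_eq)

lemma word_step:
  assumes "word x s n = word y t n" "x (s + int n) = y (t + int n)"
  shows "word x (s + 1) n = word y (t + 1) n"
  unfolding word_eq_iff
proof (intro allI impI)
  fix i assume "i < n"
  then show "x (s + 1 + int i) = y (t + 1 + int i)"
    using iffD2[OF word_Suc_eq_iff conjI[OF assms], unfolded word_eq_iff, rule_format, of "Suc i"]
    by (simp add: ac_simps)
qed

lemma take_word: "m \<le> n \<Longrightarrow> take m (word x t n) = word x t m"
  by (simp add: word_def take_map)

lemma language_eq: "language X n = (\<lambda>x. word x 0 n) ` X"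
proof -
  have eq: "length w = n \<and> (\<forall>i<n. x (int i) = w ! i) \<longleftrightarrow> w = word x 0 n" for w and x :: "int \<Rightarrow> 'a"
    unfolding list_eq_iff_nth_eq[of w] by (auto simp: word_def)
  have "language X n = {w. \<exists>x\<in>X. length w = n \<and> (\<forall>i<n. x (int i) = w ! i)}"
    unfolding language_def by blast
  also have "\<dots> = {w. \<exists>x\<in>X. w = word x 0 n}"
    unfolding eq ..
  also have "\<dots> = (\<lambda>x. word x 0 n) ` X"
    by blast
  finally show ?thesis .
qed

lemma finite_language:
  assumes "finite A" "subshift A X"
  shows "finite (language X n)"
proof (rule finite_subset)
  have "X \<subseteq> {x. range x \<subseteq> A}"
    using assms(2) closedin_subset topspace_full_shift unfolding subshift_def by metis
  then show "language X n \<subseteq> {w. set w \<subseteq> A \<and> length w = n}"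
    unfolding language_eq word_def by (auto simp: subset_iff)
qed (use assms(1) finite_lists_length_eq in auto)

text \<open>For \<open>k = 1\<close> the backward direction combines surjectivity of the shift on
  \<open>X\<close> with its injectivity on all sequences; induction in both directions reaches every
  integer.\<close>

lemma translate_in_iff:
  assumes "subshift A X"
  shows "translate k x \<in> X \<longleftrightarrow> x \<in> X"
proof -
  have 1: "translate 1 x \<in> X \<longleftrightarrow> x \<in> X" for x
  proof
    assume "translate 1 x \<in> X"
    then obtain y where y: "y \<in> X" "shift y = translate 1 x"
      using assms unfolding subshift_def by (metis imageE)
    have "y i = x i" for i
      using fun_cong[OF y(2), of "i - 1"] by (simp add: shift_def translate_def)
    then have "y = x" by blast
    then show "x \<in> X" using y by simp
  next
    assume "x \<in> X"
    then have "shift x \<in> X" using assms unfolding subshift_def by blast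
    then show "translate 1 x \<in> X" by (simp add: shift_def translate_def)
  qed
  have [simp]: "translate k (translate l x) = translate (k + l) x" for k l :: int and x :: "int \<Rightarrow> 'a"
    by (simp add: translate_def add.assoc)
  show ?thesis
  proof (induction k rule: int_induct[of _ 0])
    case base
    then show ?case by (simp add: translate_def)
  next
    case (step1 i)
    then show ?case using 1[of "translate i x"] by (simp add: add.commute)
  next
    case (step2 i)
    then show ?case using 1[of "translate (i - 1) x"] by simp
  qed
qed

lemma word_in_language:
  assumes "subshift A X" "x \<in> X"
  shows "word x t n \<in> language X n"
  unfolding language_eq
  using translate_in_iff[OF assms(1), of t x] assms(2) by (auto simp: word_translate intro!: image_eqI[of _ _ "translate t x"])

lemma complexity_mono:
  assumes "finite A" "subshift A X" "m \<le> n"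
  shows "complexity X m \<le> complexity X n"
proof -
  have "language X m = take m ` language X n"
    using assms(3) by (auto simp: language_eq image_image take_word)
  then show ?thesis
    unfolding complexity_def using card_image_le finite_language[OF assms(1,2)] by metis
qed

section \<open>Right special words and forced extensions\<close>

definition right_special :: "(int \<Rightarrow> 'a) set \<Rightarrow> nat \<Rightarrow> 'a list \<Rightarrow> bool" where
  "right_special X n w \<longleftrightarrow>
     (\<exists>x\<in>X. \<exists>y\<in>X. word x 0 n = w \<and> word y 0 n = w \<and> x (int n) \<noteq> y (int n))"

text \<open>Membership of \<open>x\<close> and \<open>y\<close> in \<open>X\<close> is replaced by
  legality of the words read off them, so that periodic sequences known only through their words are
  covered.\<close>

lemma unique_extension:
  assumes "word x s (Suc n) \<in> language X (Suc n)" "word y t (Suc n) \<in> language X (Suc n)"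
    and "word x s n = word y t n" "\<not> right_special X n (word x s n)"
  shows "x (s + int n) = y (t + int n)"
proof -
  obtain x' y' where xy: "x' \<in> X" "word x s (Suc n) = word x' 0 (Suc n)"
    "y' \<in> X" "word y t (Suc n) = word y' 0 (Suc n)"
    using assms(1,2) unfolding language_eq by blast
  then have "x' (int n) = y' (int n)"
    using assms(3,4) unfolding right_special_def word_Suc_eq_iff by metis
  then show ?thesis
    using xy unfolding word_Suc_eq_iff by simp
qed

text \<open>Truncation maps the words of length \<open>Suc n\<close> onto those of length
  \<open>n\<close>. Fibres over right special words have at least two elements, the others one, so
  the growth of the complexity is at least half the number of extensions of right special words. The
  additive form avoids truncated subtraction.\<close>

lemma card_special_extensions:
  assumes "finite A" "subshift A X"
  shows "card {v \<in> language X (Suc n). right_special X n (take n v)} + 2 * complexity X n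
    \<le> 2 * complexity X (Suc n)"
proof -
  define L where "L = language X (Suc n)"
  define V where "V = {v \<in> L. right_special X n (take n v)}"
  have fin: "finite L" "finite V"
    using finite_language[OF assms] by (auto simp: L_def V_def)
  have im: "take n ` L = language X n"
    by (auto simp: L_def language_eq image_image take_word)
  have inj: "inj_on (take n) (L - V)"
  proof (rule inj_onI)
    fix v w assume "v \<in> L - V" "w \<in> L - V" and eq: "take n v = take n w"
    then obtain x y where xy: "x \<in> X" "y \<in> X" "v = word x 0 (Suc n)" "w = word y 0 (Suc n)"
      "\<not> right_special X n (take n v)"
      by (auto simp: L_def V_def language_eq)
    then have "word x 0 n = word y 0 n" "\<not> right_special X n (word x 0 n)"
      using eq by (auto simp: take_word)
    then show "v = w"
      using unique_extension[of x 0 n X y 0] xy(1-4) word_in_language[OF assms(2)] word_Suc_eq_iff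
      by blast
  qed
  define W where "W = take n ` V"
  have "finite W" using fin by (simp add: W_def)
  have fiber: "2 \<le> card {v \<in> V. take n v = w}" if "w \<in> W" for w
  proof -
    have rs: "right_special X n w" using that by (auto simp: W_def V_def)
    then obtain x y where xy: "x \<in> X" "y \<in> X" "word x 0 n = w" "word y 0 n = w" "x (int n) \<noteq> y (int n)"
      unfolding right_special_def by blast
    have "word x 0 (Suc n) \<noteq> word y 0 (Suc n)"
      using xy(5) word_Suc_eq_iff[of x 0 n y 0] by simp
    then have "2 = card {word x 0 (Suc n), word y 0 (Suc n)}" by simp
    also have "\<dots> \<le> card {v \<in> V. take n v = w}"
      using xy rs fin by (intro card_mono) (auto simp: V_def L_def language_eq take_word)
    finally show ?thesis .
  qed
  \<comment> \<open>Count \<open>V\<close> by the fibres of truncation.\<close>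
  have "card W * 2 \<le> (\<Sum>w\<in>W. card {v \<in> V. take n v = w})"
    using sum_mono[of W "\<lambda>_. 2" "\<lambda>w. card {v \<in> V. take n v = w}"] fiber by simp
  also have "\<dots> = card V"
    using sum.image_gen[OF fin(2), of "\<lambda>_. 1::nat" "take n"]
    by (simp add: W_def card_eq_sum del: sum_constant)
  finally have "card W * 2 \<le> card V" .
  moreover have "complexity X n \<le> card W + card (L - V)"
  proof -
    have "language X n = W \<union> take n ` (L - V)"
      unfolding im[symmetric] W_def by (auto simp: V_def)
    then have "complexity X n \<le> card W + card (take n ` (L - V))"
      unfolding complexity_def by (metis card_Un_le)
    also have "card (take n ` (L - V)) = card (L - V)"
      using inj by (rule card_image)
    finally show ?thesis .
  qed
  moreover have "card (L - V) = complexity X (Suc n) - card V" "card V \<le> complexity X (Suc n)"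
    unfolding complexity_def L_def[symmetric]
    using fin by (auto simp: V_def intro!: card_Diff_subset card_mono)
  ultimately show ?thesis
    unfolding V_def[symmetric] L_def[symmetric] by linarith
qed

section \<open>Periodic points\<close>

lemma translate_translate: "translate k (translate l x) = translate (k + l) x"
  by (simp add: translate_def add.assoc)

lemma translate_0 [simp]: "translate 0 x = x"
  by (simp add: translate_def)

lemma translate_inj_iff: "translate k x = translate k y \<longleftrightarrow> x = y"
proof
  assume "translate k x = translate k y"
  then have "translate (- k) (translate k x) = translate (- k) (translate k y)" by simp
  then show "x = y" by (simp add: translate_translate)
qed simp

text \<open>Take one point per orbit. Its first \<open>a\<close> translates are distinct and lie in
  \<open>E\<close>, so \<open>T \<times> {..<a}\<close> injects into \<open>E\<close>.\<close>

lemma orbit_representatives: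
  fixes E :: "(int \<Rightarrow> 'a) set"
  assumes "finite E" "\<And>z k. z \<in> E \<Longrightarrow> translate k z \<in> E"
    and aperiodic: "\<And>z i. \<lbrakk>z \<in> E; 0 < i; i < a\<rbrakk> \<Longrightarrow> translate (int i) z \<noteq> z"
  obtains T where "T \<subseteq> E" "card T * a \<le> card E" "\<And>z. z \<in> E \<Longrightarrow> \<exists>y\<in>T. \<exists>k. z = translate k y"
proof -
  define orb :: "(int \<Rightarrow> 'a) \<Rightarrow> (int \<Rightarrow> 'a) set" where "orb = (\<lambda>z. range (\<lambda>k. translate k z))"
  \<comment> \<open>The choice depends only on the orbit as a set, hence is constant along each
    orbit.\<close>
  define rep where "rep = (\<lambda>z. SOME y. y \<in> orb z)"
  have rep_orb: "rep z \<in> orb z" for z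
    unfolding rep_def by (rule someI[of _ z]) (auto simp: orb_def intro: range_eqI[of _ _ 0])
  then have ex: "\<exists>k. rep z = translate k z" for z
    by (auto simp: orb_def)
  have orb_translate: "orb (translate k z) = orb z" for k z
  proof -
    have "translate l z \<in> orb (translate k z)" for l
      unfolding orb_def by (rule range_eqI[of _ _ "l - k"]) (simp add: translate_translate)
    then show ?thesis by (auto simp: orb_def translate_translate)
  qed
  have rep_translate: "rep (translate k z) = rep z" for k z
    unfolding rep_def orb_translate ..
  have rep_rep: "rep (rep z) = rep z" for z
    using ex[of z] rep_translate by metis
  define T where "T = rep ` E"
  have "rep z \<in> E" if "z \<in> E" for z
    using ex[of z] assms(2) that by auto
  then have "T \<subseteq> E" by (auto simp: T_def)
  moreover have "card T * a \<le> card E"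
  proof -
    have "inj_on (\<lambda>(y, i). translate (int i) y) (T \<times> {..<a})"
    proof (rule inj_onI)
      fix u v assume "u \<in> T \<times> {..<a}" "v \<in> T \<times> {..<a}"
        "(\<lambda>(y, i). translate (int i) y) u = (\<lambda>(y, i). translate (int i) y) v"
      then obtain y i y' j where uv: "u = (y, i)" "v = (y', j)"
        and y: "y \<in> T" "y' \<in> T" "i < a" "j < a"
        and eq: "translate (int i) y = translate (int j) y'"
        by (cases u; cases v) auto
      have "y = y'"
        using arg_cong[OF eq, of rep] y(1,2) by (auto simp: rep_translate rep_rep T_def)
      have False if "i < j" "translate (int i) y = translate (int j) y" "j < a" for i j
      proof -
        have "translate (int (j - i)) y = translate (- int i) (translate (int j) y)"
          using that(1) by (simp add: translate_translate of_nat_diff)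
        also have "\<dots> = y"
          unfolding that(2)[symmetric] by (simp add: translate_translate)
        finally show False
          using aperiodic[of y "j - i"] that(1,3) y(1) \<open>T \<subseteq> E\<close>
          by (metis less_imp_diff_less subsetD zero_less_diff)
      qed
      from this[of i j] this[of j i] show "u = v"
        using eq y(3,4) \<open>y = y'\<close> uv by (cases i j rule: linorder_cases) auto
    qed
    then have "card (T \<times> {..<a}) \<le> card E"
      using assms(1,2) \<open>T \<subseteq> E\<close> by (intro card_inj_on_le) auto
    then show ?thesis by (simp add: card_cartesian_product)
  qed
  moreover have "\<exists>y\<in>T. \<exists>k. z = translate k y" if "z \<in> E" for z
  proof -
    obtain k where "rep z = translate k z" using ex by blast
    then have "z = translate (- k) (rep z)" by (simp add: translate_translate)
    then show ?thesis using that by (auto simp: T_def)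
  qed
  ultimately show ?thesis by (rule that)
qed

definition is_period :: "(int \<Rightarrow> 'a) \<Rightarrow> nat \<Rightarrow> bool" where
  "is_period z q \<longleftrightarrow> q > 0 \<and> translate (int q) z = z"

lemma is_period_add: "is_period z q \<Longrightarrow> z (i + int q) = z i"
  by (metis is_period_def translate_def)

lemma is_period_mod_add:
  assumes "is_period z q"
  shows "z (i mod int q + j) = z (i + j)"
proof -
  note step = is_period_add[OF assms]
  have "z (i + k * int q) = z i" for i k
  proof (induction k rule: int_induct[of _ 0])
    case (step1 k)
    then show ?case using step[of "i + k * int q"] by (simp add: algebra_simps)
  next
    case (step2 k)
    then show ?case using step[of "i + (k - 1) * int q"] by (simp add: algebra_simps)
  qed simp
  moreover have "i mod int q + j + i div int q * int q = i + j"
    using div_mult_mod_eq[of i "int q"] by linarith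
  ultimately show ?thesis by metis
qed

lemma is_period_mod: "is_period z q \<Longrightarrow> z (i mod int q) = z i"
  using is_period_mod_add[of z q i 0] by simp

lemma is_period_word_mod:
  assumes "is_period z q"
  shows "word z (t mod int q) n = word z t n"
  by (simp add: word_eq_iff is_period_mod_add[OF assms])

lemma is_period_translate: "is_period (translate k z) q \<longleftrightarrow> is_period z q"
proof -
  have "translate (int q) (translate k z) = translate k (translate (int q) z)"
    by (simp add: translate_translate add.commute)
  then show ?thesis by (simp add: is_period_def translate_inj_iff)
qed

text \<open>For \<open>i\<close> in \<open>[0, p)\<close> both \<open>i\<close> and
  \<open>i + q\<close> lie in the window where \<open>x\<close> and \<open>y\<close> agree, so
  \<open>x\<close> inherits the period \<open>q\<close>. Then \<open>q\<close> common letters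
  determine both sequences. The sharp theorem needs only \<open>p + q - gcd p q\<close>
  letters.\<close>

lemma weak_Fine_Wilf:
  assumes x: "is_period x p" and y: "is_period y q" and "p + q \<le> l" and eq: "word x 0 l = word y 0 l"
  shows "x = y"
proof -
  have eq': "x i = y i" if "0 \<le> i" "i < int p + int q" for i
    using eq[unfolded word_eq_iff, rule_format, of "nat i"] that assms(3) by simp
  have pos: "p > 0" "q > 0" using x y by (auto simp: is_period_def)
  have "x (i + int q) = x i" for i
  proof -
    have "x (i mod int p + int q) = y (i mod int p + int q)"
    proof (rule eq')
      show "0 \<le> i mod int p + int q" using pos by simp
      have "i mod int p < int p" using pos by simp
      then show "i mod int p + int q < int p + int q" by simp
    qed
    also have "\<dots> = y (i mod int p)"
      by (rule is_period_add[OF y])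
    also have "\<dots> = x (i mod int p)"
      using pos pos_mod_bound[of "int p" i] by (intro eq'[symmetric] pos_mod_sign) linarith+
    finally show ?thesis
      by (simp only: is_period_mod_add[OF x] is_period_mod[OF x])
  qed
  then have x': "is_period x q"
    using pos by (auto simp: is_period_def translate_def)
  show ?thesis
  proof
    fix i
    have "x (i mod int q) = y (i mod int q)"
      using pos pos_mod_bound[of "int q" i] by (intro eq' pos_mod_sign) linarith+
    then show "x i = y i"
      by (simp only: is_period_mod[OF x'] is_period_mod[OF y])
  qed
qed

text \<open>Legality of all finite words stands for membership in \<open>X\<close>. It is what a
  cycle in the Rauzy graph provides directly, without a limit argument.\<close>

definition periodic_points :: "(int \<Rightarrow> 'a) set \<Rightarrow> (int \<Rightarrow> 'a) set" where
  "periodic_points X = {z. (\<exists>q. is_period z q) \<and> (\<forall>t n. word z t n \<in> language X n)}"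

definition least_period :: "(int \<Rightarrow> 'a) \<Rightarrow> nat" where
  "least_period z = (LEAST q. is_period z q)"

lemma least_period:
  assumes "z \<in> periodic_points X"
  shows "is_period z (least_period z)"
  using assms unfolding periodic_points_def least_period_def by (auto intro: LeastI)

lemma translate_periodic_points:
  "z \<in> periodic_points X \<Longrightarrow> translate k z \<in> periodic_points X"
  unfolding periodic_points_def by (auto simp: word_translate is_period_translate)

lemma least_period_translate [simp]: "least_period (translate k z) = least_period z"
  by (simp add: least_period_def is_period_translate)

text \<open>Injectivity of reading \<open>l\<close> letters bounds the points of \<open>E\<close> by
  the number of words of length \<open>l\<close>, and each orbit accounts for at least
  \<open>a\<close> of them.\<close>

lemma orbit_representatives_le_complexity:
  assumes "finite A" "subshift A X" "E \<subseteq> periodic_points X" "\<And>z k. z \<in> E \<Longrightarrow> translate k z \<in> E"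
    and inj: "inj_on (\<lambda>z. word z 0 l) E"
    and "a > 0" "\<And>z. z \<in> E \<Longrightarrow> a \<le> least_period z"
  obtains T where "T \<subseteq> E" "finite T" "card T \<le> complexity X l div a"
    "\<And>z. z \<in> E \<Longrightarrow> \<exists>y\<in>T. \<exists>k. z = translate k y"
proof -
  have sub: "(\<lambda>z. word z 0 l) ` E \<subseteq> language X l"
    using assms(3) by (auto simp: periodic_points_def)
  have "finite E"
    using inj sub finite_language[OF assms(1,2)] inj_on_finite by blast
  have "card E \<le> complexity X l"
    unfolding complexity_def using inj sub finite_language[OF assms(1,2)] by (intro card_inj_on_le)
  obtain T where T: "T \<subseteq> E" "card T * a \<le> card E" "\<And>z. z \<in> E \<Longrightarrow> \<exists>y\<in>T. \<exists>k. z = translate k y"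
  proof (rule orbit_representatives[OF \<open>finite E\<close> assms(4)])
    fix z i assume "z \<in> E" "0 < i" "i < a"
    then have "i < least_period z" using assms(7)[of z] by simp
    then show "translate (int i) z \<noteq> z"
      using \<open>0 < i\<close> not_less_Least[of i "is_period z"] by (auto simp: least_period_def is_period_def)
  qed blast+
  have "card T \<le> complexity X l div a"
    using T(2) \<open>card E \<le> complexity X l\<close> \<open>a > 0\<close> by (simp add: less_eq_div_iff_mult_less_eq)
  then show ?thesis using that T \<open>finite E\<close> finite_subset by blast
qed

section \<open>Cycles in the Rauzy graph\<close>

text \<open>A vertex of the Rauzy graph that is not right special has a single successor, so two
  walks through a common vertex stay together until they have met a right special word.\<close>

lemma deterministic_continuation:
  assumes x: "\<And>t n. word x t n \<in> language X n" and y: "\<And>t n. word y t n \<in> language X n"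
    and eq: "word x s n = word y t n"
    and "\<And>i. i < k \<Longrightarrow> \<not> right_special X n (word x (s + int i) n)"
  shows "word x (s + int k) n = word y (t + int k) n"
  using assms(4)
proof (induction k)
  case (Suc k)
  then have IH: "word x (s + int k) n = word y (t + int k) n" by simp
  have "x (s + int k + int n) = y (t + int k + int n)"
    using Suc.prems by (intro unique_extension[OF x y IH]) simp
  from word_step[OF IH this] show ?case by (simp add: ac_simps)
qed (use eq in simp)

text \<open>The walk of \<open>y\<close> returns to a vertex after \<open>q\<close> forced steps, so
  it must go round the same cycle forever. Thus \<open>y\<close> is periodic to the right of
  \<open>s\<close>, and \<open>z\<close> is the two-sided periodic continuation of that
  half.\<close>

lemma cycle_in_periodic_points:
  assumes "subshift A X" "y \<in> X" "n > 0" "q > 0"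
    and eq: "word y s n = word y (s + int q) n"
    and nonspecial: "\<And>i. i < q \<Longrightarrow> \<not> right_special X n (word y (s + int i) n)"
  obtains z where "z \<in> periodic_points X" "is_period z q"
    "\<And>t. \<not> right_special X n (word z t n)" "\<And>k m. word z (int k) m = word y (s + int k) m"
proof -
  have y: "word y t m \<in> language X m" for t m
    by (rule word_in_language[OF assms(1,2)])
  \<comment> \<open>From \<open>q\<close> steps on, each window equals the one \<open>q\<close>
    steps earlier, because all steps in between are forced.\<close>
  have ns: "\<not> right_special X n (word y (s + int k) n)" for k
  proof (induction k rule: less_induct)
    case (less k)
    show ?case
    proof (cases "k < q")
      case False
      have "word y (s + int (k - q)) n = word y (s + int q + int (k - q)) n"
        using less False \<open>q > 0\<close> by (intro deterministic_continuation[OF y y eq]) auto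
      moreover have "\<not> right_special X n (word y (s + int (k - q)) n)"
        using less[of "k - q"] False \<open>q > 0\<close> by linarith
      ultimately show ?thesis using False by (simp add: of_nat_diff)
    qed (use nonspecial in simp)
  qed
  have shift_q: "y (s + int (k + q)) = y (s + int k)" for k
    using deterministic_continuation[OF y y eq ns, of k, unfolded word_eq_iff, rule_format, of 0] \<open>n > 0\<close>
    by (simp add: ac_simps)
  have "y (s + int (r + m * q)) = y (s + int r)" for r m
  proof (induction m)
    case (Suc m)
    then show ?case using shift_q[of "r + m * q"] by (simp add: algebra_simps)
  qed simp
  from this[of "k mod q" "k div q" for k]
  have y_mod: "y (s + int (k mod q)) = y (s + int k)" for k
    by simp
  \<comment> \<open>The integer remainder is nonnegative, so negative positions are also filled from
    the cycle.\<close>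
  define z where "z = (\<lambda>i. y (s + i mod int q))"
  have per: "is_period z q"
    using \<open>q > 0\<close> by (simp add: is_period_def translate_def z_def)
  have word_z: "word z (int k) m = word y (s + int k) m" for k m
    unfolding word_eq_iff z_def by (metis y_mod add.assoc of_nat_add zmod_int)
  have "\<exists>k. word z t m = word z (int k) m" for t m
    using is_period_word_mod[OF per, of t m] \<open>q > 0\<close>
    by (intro exI[of _ "nat (t mod int q)"]) simp
  then have *: "\<exists>k. word z t m = word y (s + int k) m" for t m
    unfolding word_z by blast
  have "word z t m \<in> language X m" for t m
    using *[of t m] y by metis
  then have "z \<in> periodic_points X"
    using per by (auto simp: periodic_points_def)
  moreover have "\<not> right_special X n (word z t n)" for t
    using *[of t n] ns by metis
  ultimately show ?thesis using that per word_z by blast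
qed

text \<open>Least periods below \<open>2 ^ J\<close> are sorted into dyadic classes, where few
  letters identify a point. Sequences of longer period are identified by \<open>n\<close> letters,
  as their walks never meet a right special word.\<close>

lemma cycle_representatives:
  assumes "finite A" "subshift A X" "n > 0"
  obtains T where "T \<subseteq> periodic_points X" "finite T"
    "card T \<le> (\<Sum>j<J. complexity X (2 ^ (j + 2)) div 2 ^ j) + complexity X n div 2 ^ J"
    "\<And>z. \<lbrakk>z \<in> periodic_points X; \<And>t. \<not> right_special X n (word z t n)\<rbrakk> \<Longrightarrow>
      \<exists>y\<in>T. \<exists>k. z = translate k y"
proof -
  define E where "E = (\<lambda>j. {z \<in> periodic_points X. 2 ^ j \<le> least_period z \<and> least_period z < 2 ^ (j + 1)})"
  define E' where "E' = {z \<in> periodic_points X. 2 ^ J \<le> least_period z \<and>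
    (\<forall>t. \<not> right_special X n (word z t n))}"
  have "\<exists>T\<subseteq>E j. finite T \<and> card T \<le> complexity X (2 ^ (j + 2)) div 2 ^ j \<and>
      (\<forall>z\<in>E j. \<exists>y\<in>T. \<exists>k. z = translate k y)" for j
  proof -
    \<comment> \<open>Two periods below \<open>2 ^ (j + 1)\<close> add up to less than
      \<open>2 ^ (j + 2)\<close>.\<close>
    have inj: "inj_on (\<lambda>z. word z 0 (2 ^ (j + 2))) (E j)"
      by (intro inj_onI weak_Fine_Wilf[OF least_period least_period]) (auto simp: E_def)
    obtain T where "T \<subseteq> E j" "finite T" "card T \<le> complexity X (2 ^ (j + 2)) div 2 ^ j"
      "\<And>z. z \<in> E j \<Longrightarrow> \<exists>y\<in>T. \<exists>k. z = translate k y"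
      by (rule orbit_representatives_le_complexity[OF assms(1,2) _ _ inj, of "2 ^ j"])
         (auto simp: E_def translate_periodic_points)
    then show ?thesis by blast
  qed
  then obtain T where T: "\<And>j. T j \<subseteq> E j" "\<And>j. finite (T j)"
    "\<And>j. card (T j) \<le> complexity X (2 ^ (j + 2)) div 2 ^ j"
    "\<And>j z. z \<in> E j \<Longrightarrow> \<exists>y\<in>T j. \<exists>k. z = translate k y"
    by metis
  have inj: "inj_on (\<lambda>z. word z 0 n) E'"
  proof (rule inj_onI)
    fix x y assume xy: "x \<in> E'" "y \<in> E'" "word x 0 n = word y 0 n"
    then have lang: "word x t m \<in> language X m" "word y t m \<in> language X m" for t m
      by (auto simp: E'_def periodic_points_def)
    have "word x (0 + int k) n = word y (0 + int k) n" for k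
      using xy by (intro deterministic_continuation[OF lang xy(3)]) (auto simp: E'_def)
    then have nonneg: "x (int k) = y (int k)" for k
      using \<open>n > 0\<close> unfolding word_eq_iff by (metis add_0 add.right_neutral of_nat_0)
    \<comment> \<open>Forced continuation gives agreement only at nonnegative positions; periodicity
      extends it to the negative ones.\<close>
    have "word x 0 (least_period x + least_period y) = word y 0 (least_period x + least_period y)"
      unfolding word_eq_iff by (simp add: nonneg)
    then show "x = y"
      using xy by (intro weak_Fine_Wilf[OF least_period least_period]) (auto simp: E'_def)
  qed
  obtain T' where T': "T' \<subseteq> E'" "finite T'" "card T' \<le> complexity X n div 2 ^ J"
    "\<And>z. z \<in> E' \<Longrightarrow> \<exists>y\<in>T'. \<exists>k. z = translate k y"
    by (rule orbit_representatives_le_complexity[OF assms(1,2) _ _ inj, of "2 ^ J"])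
       (auto simp: E'_def translate_periodic_points word_translate)
  define R where "R = (\<Union>j<J. T j) \<union> T'"
  have "card R \<le> card (\<Union>j<J. T j) + card T'"
    unfolding R_def by (rule card_Un_le)
  also have "card (\<Union>j<J. T j) \<le> (\<Sum>j<J. card (T j))"
    by (rule card_UN_le) simp
  also have "\<dots> \<le> (\<Sum>j<J. complexity X (2 ^ (j + 2)) div 2 ^ j)"
    by (intro sum_mono T(3))
  finally have "card R \<le> (\<Sum>j<J. complexity X (2 ^ (j + 2)) div 2 ^ j) + complexity X n div 2 ^ J"
    using T'(3) by simp
  moreover have "\<exists>y\<in>R. \<exists>k. z = translate k y"
    if z: "z \<in> periodic_points X" "\<And>t. \<not> right_special X n (word z t n)" for z
  proof (cases "2 ^ J \<le> least_period z")
    case True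
    then have "z \<in> E'" using z by (auto simp: E'_def)
    from T'(4)[OF this] show ?thesis unfolding R_def by blast
  next
    case False
    have "least_period z \<noteq> 0" using least_period[OF z(1)] by (simp add: is_period_def)
    then obtain j where j: "2 ^ j \<le> least_period z" "least_period z < 2 ^ (j + 1)"
      using ex_power_ivl1[of 2 "least_period z"] by auto
    then have "(2::nat) ^ j < 2 ^ J" using False by linarith
    then have "j < J" by simp
    moreover have "z \<in> E j" using j z by (auto simp: E_def)
    ultimately show ?thesis using T(4)[of z j] unfolding R_def by blast
  qed
  moreover have "R \<subseteq> periodic_points X" "finite R"
    using T(1,2) T'(1,2) by (auto simp: R_def E_def E'_def)
  ultimately show ?thesis using that by blast
qed

text \<open>Follow a point backwards from the origin: either a right special word occurs, and then the
  word at the origin is a forced continuation of one of its extensions, or the walk in the Rauzy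
  graph closes up to a cycle that cannot be left.\<close>

lemma covering_points:
  assumes "finite A" "subshift A X" "n > 0"
  obtains Q where "Q \<subseteq> X" "finite Q"
    "card Q + 2 * complexity X n \<le> 2 * complexity X (Suc n) +
      ((\<Sum>j<J. complexity X (2 ^ (j + 2)) div 2 ^ j) + complexity X n div 2 ^ J)"
    "\<And>y. y \<in> X \<Longrightarrow> \<exists>x\<in>Q. \<exists>t\<le>complexity X n. word y 0 n = word x (int t) n"
proof -
  define p where "p = complexity X n"
  \<comment> \<open>A prefix of this length contains all windows of length \<open>n\<close> at
    offsets up to \<open>p\<close>.\<close>
  define K where "K = n + p"
  define V where "V = {v \<in> language X (Suc n). right_special X n (take n v)}"
  obtain T where T: "T \<subseteq> periodic_points X" "finite T"
    "card T \<le> (\<Sum>j<J. complexity X (2 ^ (j + 2)) div 2 ^ j) + complexity X n div 2 ^ J"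
    "\<And>z. \<lbrakk>z \<in> periodic_points X; \<And>t. \<not> right_special X n (word z t n)\<rbrakk> \<Longrightarrow>
      \<exists>y\<in>T. \<exists>k. z = translate k y"
    using cycle_representatives[OF assms] by blast
  have "\<exists>x\<in>X. word x 0 K = word z 0 K" if "z \<in> T" for z
  proof -
    have "word z 0 K \<in> language X K"
      using that T(1) by (auto simp: periodic_points_def)
    then obtain x where "word z 0 K = word x 0 K" "x \<in> X"
      unfolding language_eq by (rule imageE)
    then show ?thesis by (intro bexI[of _ x]) simp_all
  qed
  then obtain a where a: "\<And>z. z \<in> T \<Longrightarrow> a z \<in> X" "\<And>z. z \<in> T \<Longrightarrow> word (a z) 0 K = word z 0 K"
    by metis
  have "\<exists>x\<in>X. word x 0 (Suc n) = v" if "v \<in> V" for v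
    using that unfolding V_def language_eq by blast
  then obtain b where b: "\<And>v. v \<in> V \<Longrightarrow> b v \<in> X" "\<And>v. v \<in> V \<Longrightarrow> word (b v) 0 (Suc n) = v"
    by metis
  define Q where "Q = b ` V \<union> a ` T"
  have "finite V" using finite_language[OF assms(1,2)] by (simp add: V_def)
  have "card Q \<le> card (b ` V) + card (a ` T)"
    unfolding Q_def by (rule card_Un_le)
  also have "\<dots> \<le> card V + card T"
    using \<open>finite V\<close> T(2) by (intro add_mono card_image_le)
  finally have "card Q + 2 * complexity X n \<le> 2 * complexity X (Suc n) +
      ((\<Sum>j<J. complexity X (2 ^ (j + 2)) div 2 ^ j) + complexity X n div 2 ^ J)"
    using card_special_extensions[OF assms(1,2), of n] T(3) unfolding V_def by linarith
  moreover have "\<exists>x\<in>Q. \<exists>t\<le>p. word y 0 n = word x (int t) n" if y: "y \<in> X" for y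
  proof (cases "\<exists>j. 0 < j \<and> j \<le> p \<and> right_special X n (word y (- int j) n)")
    case True
    \<comment> \<open>This is the last right special word before the origin. After its extension by
      one letter, the walk to the origin is forced.\<close>
    define j where "j = (LEAST j. 0 < j \<and> j \<le> p \<and> right_special X n (word y (- int j) n))"
    have j: "0 < j" "j \<le> p" "right_special X n (word y (- int j) n)"
      using LeastI_ex[OF True] unfolding j_def by auto
    have least: "\<not> right_special X n (word y (- int i) n)" if "0 < i" "i < j" for i
      using not_less_Least[of i] that j(2) unfolding j_def by fastforce
    define v where "v = word y (- int j) (Suc n)"
    have v: "v \<in> V"
      using word_in_language[OF assms(2) y] j(3) by (simp add: V_def v_def take_word)
    have lang: "word y t m \<in> language X m" "word (b v) t m \<in> language X m" for t m
      using word_in_language[OF assms(2)] y b(1)[OF v] by auto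
    have "word y (- int j) (Suc n) = word (b v) 0 (Suc n)"
      using b(2)[OF v] by (simp add: v_def)
    then have "word y (- int j + 1) n = word (b v) (0 + 1) n"
      unfolding word_Suc_eq_iff by (intro word_step) auto
    then have "word y (- int j + 1 + int (j - 1)) n = word (b v) (0 + 1 + int (j - 1)) n"
    proof (rule deterministic_continuation[OF lang])
      fix i assume "i < j - 1"
      then show "\<not> right_special X n (word y (- int j + 1 + int i) n)"
        using least[of "j - 1 - i"] by (simp add: of_nat_diff algebra_simps)
    qed
    then have "word y 0 n = word (b v) (int j) n"
      using j(1) by (simp add: of_nat_diff)
    then show ?thesis using j(2) v by (auto simp: Q_def)
  next
    case False
    \<comment> \<open>Pigeonhole: \<open>p + 1\<close> positions carry at most \<open>p\<close>
      words, so the walk closes up.\<close>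
    have "\<not> inj_on (\<lambda>j. word y (- int j) n) {..p}"
    proof
      assume "inj_on (\<lambda>j. word y (- int j) n) {..p}"
      then have "card {..p} \<le> complexity X n"
        unfolding complexity_def using word_in_language[OF assms(2) y] finite_language[OF assms(1,2)]
        by (intro card_inj_on_le) auto
      then show False by (simp add: p_def)
    qed
    then obtain i j where ij: "i < j" "j \<le> p" "word y (- int j) n = word y (- int i) n"
      unfolding inj_on_def by (metis atMost_iff linorder_neqE_nat)
    define q where "q = j - i"
    have q: "0 < q" "q \<le> p" using ij by (auto simp: q_def)
    obtain z where z: "z \<in> periodic_points X" "is_period z q"
      "\<And>t. \<not> right_special X n (word z t n)" "\<And>k m. word z (int k) m = word y (- int j + int k) m"
    proof (rule cycle_in_periodic_points[OF assms(2) y \<open>n > 0\<close> q(1)])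
      show "word y (- int j) n = word y (- int j + int q) n"
        using ij by (simp add: q_def of_nat_diff)
      show "\<not> right_special X n (word y (- int j + int l) n)" if "l < q" for l
      proof -
        have "0 < j - l" "j - l \<le> p" "- int j + int l = - int (j - l)"
          using that ij by (auto simp: q_def of_nat_diff)
        then show ?thesis using False by metis
      qed
    qed blast
    then obtain y' k where y': "y' \<in> T" "z = translate k y'" using T(4) by blast
    \<comment> \<open>Reducing the phase modulo the period \<open>q \<le> p\<close> moves the word
      into the prefix on which \<open>a y'\<close> copies \<open>y'\<close>.\<close>
    define t where "t = nat ((int j + k) mod int q)"
    have t: "int t = (int j + k) mod int q" "t \<le> p"
    proof -
      have "0 \<le> (int j + k) mod int q" "(int j + k) mod int q < int q" using q(1) by auto
      then show "int t = (int j + k) mod int q" "t \<le> p"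
        using q(2) unfolding t_def by linarith+
    qed
    have "word y 0 n = word z (int j) n" using z(4)[of j n] by simp
    also have "\<dots> = word y' (int j + k) n" using y'(2) by (simp add: word_translate)
    also have "\<dots> = word y' (int t) n"
      using z(2) y'(2) is_period_word_mod t(1) by (metis is_period_translate)
    also have "\<dots> = word (a y') (int t) n"
      unfolding word_eq_iff
    proof (intro allI impI)
      fix i assume "i < n"
      then show "y' (int t + int i) = a y' (int t + int i)"
        using a(2)[OF y'(1), unfolded word_eq_iff, rule_format, of "t + i"] t(2) by (simp add: K_def)
    qed
    finally show ?thesis using y'(1) t(2) by (auto simp: Q_def)
  qed
  moreover have "Q \<subseteq> X" "finite Q"
    using a(1) b(1) \<open>finite V\<close> T(2) by (auto simp: Q_def)
  ultimately show ?thesis using that unfolding p_def by blast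
qed

section \<open>Automorphisms of bounded range\<close>

lemma shift_AutD:
  assumes "subshift A X" "\<phi> \<in> carrier (shift_Aut A X)"
  shows "x \<in> X \<Longrightarrow> \<phi> x \<in> X" and "\<phi> \<in> extensional X"
    and "x \<in> X \<Longrightarrow> \<phi> (translate k x) = translate k (\<phi> x)"
    and "continuous_map (subtopology (full_shift A) X) (subtopology (full_shift A) X) \<phi>"
proof -
  have \<phi>: "\<phi> \<in> Bij X" "\<And>x. x \<in> X \<Longrightarrow> \<phi> (shift x) = shift (\<phi> x)"
    "homeomorphic_map (subtopology (full_shift A) X) (subtopology (full_shift A) X) \<phi>"
    using assms(2) by (auto simp: shift_Aut_def)
  then show "\<phi> \<in> extensional X" "x \<in> X \<Longrightarrow> \<phi> x \<in> X"
    by (auto simp: Bij_def bij_betw_def)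
  show "continuous_map (subtopology (full_shift A) X) (subtopology (full_shift A) X) \<phi>"
    using \<phi>(3) by (rule homeomorphic_imp_continuous_map)
  have 1: "\<phi> (translate 1 x) = translate 1 (\<phi> x)" if "x \<in> X" for x
    using \<phi>(2)[OF that] by (simp add: shift_def translate_def)
  have tr: "translate k x \<in> X" if "x \<in> X" for k x
    using translate_in_iff[OF assms(1)] that by blast
  show "\<phi> (translate k x) = translate k (\<phi> x)" if "x \<in> X"
  proof (induction k rule: int_induct[of _ 0])
    case (step1 k)
    then show ?case
      using 1[OF tr[OF that, of k]] by (simp add: translate_translate add.commute)
  next
    case (step2 k)
    have "translate 1 (\<phi> (translate (k - 1) x)) = translate 1 (translate (k - 1) (\<phi> x))"
      using 1[OF tr[OF that, of "k - 1"]] step2 by (simp add: translate_translate)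
    then show ?case by (simp add: translate_inj_iff)
  qed simp
qed

text \<open>The radius of a sliding block code. Coordinate 0 suffices because automorphisms commute
  with translations.\<close>

definition has_range :: "(int \<Rightarrow> 'a) set \<Rightarrow> ((int \<Rightarrow> 'a) \<Rightarrow> int \<Rightarrow> 'a) \<Rightarrow> nat \<Rightarrow> bool" where
  "has_range X \<phi> r \<longleftrightarrow> (\<forall>x\<in>X. \<forall>y\<in>X. (\<forall>i. \<bar>i\<bar> \<le> int r \<longrightarrow> x i = y i) \<longrightarrow> \<phi> x 0 = \<phi> y 0)"

lemma has_range_mono:
  assumes "has_range X \<phi> r" "r \<le> s"
  shows "has_range X \<phi> s"
  unfolding has_range_def
proof (intro ballI impI)
  fix x y assume xy: "x \<in> X" "y \<in> X" and eq: "\<forall>i. \<bar>i\<bar> \<le> int s \<longrightarrow> x i = y i"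
  have "\<forall>i. \<bar>i\<bar> \<le> int r \<longrightarrow> x i = y i" using eq assms(2) by auto
  then show "\<phi> x 0 = \<phi> y 0" using assms(1) xy unfolding has_range_def by blast
qed

text \<open>Allowing different positions makes it possible to compare \<open>y\<close> with a point
  that contains the same word elsewhere.\<close>

lemma has_range_at:
  assumes "subshift A X" "\<phi> \<in> carrier (shift_Aut A X)" "has_range X \<phi> r" "x \<in> X" "y \<in> X"
    and "\<And>i. \<bar>i\<bar> \<le> int r \<Longrightarrow> x (s + i) = y (t + i)"
  shows "\<phi> x s = \<phi> y t"
proof -
  have "\<phi> (translate s x) 0 = \<phi> (translate t y) 0"
  proof (rule assms(3)[unfolded has_range_def, rule_format])
    show "translate s x i = translate t y i" if "\<bar>i\<bar> \<le> int r" for i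
      using assms(6)[OF that] by (simp add: translate_def add.commute)
  qed (use assms(4,5) translate_in_iff[OF assms(1)] in auto)
  then show ?thesis
    using shift_AutD(3)[OF assms(1,2)] assms(4,5) by (simp add: translate_def)
qed

lemma has_range_compose:
  assumes "subshift A X" "\<psi> \<in> carrier (shift_Aut A X)" "has_range X \<phi> r" "has_range X \<psi> s"
  shows "has_range X (compose X \<phi> \<psi>) (r + s)"
  unfolding has_range_def
proof (intro ballI impI)
  fix x y assume xy: "x \<in> X" "y \<in> X" and eq: "\<forall>i. \<bar>i\<bar> \<le> int (r + s) \<longrightarrow> x i = y i"
  have "\<psi> x j = \<psi> y j" if "\<bar>j\<bar> \<le> int r" for j
    using that eq by (intro has_range_at[OF assms(1,2,4) xy]) auto
  then show "compose X \<phi> \<psi> x 0 = compose X \<phi> \<psi> y 0"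
    using assms(3) shift_AutD(1)[OF assms(1,2)] xy by (auto simp: has_range_def compose_eq)
qed

text \<open>Continuity gives each point a radius that determines coordinate 0 of the image. The
  corresponding cylinders cover the compact set \<open>X\<close>, and the largest radius in a finite
  subcover works everywhere.\<close>

lemma Curtis_Hedlund_Lyndon:
  assumes "finite A" "subshift A X" "\<phi> \<in> carrier (shift_Aut A X)"
  shows "\<exists>r. has_range X \<phi> r"
proof -
  let ?T = "subtopology (full_shift A) X"
  have closed: "closedin (full_shift A) X"
    using assms(2) by (simp add: subshift_def)
  have XA: "x i \<in> A" if "x \<in> X" for x i
  proof -
    have "X \<subseteq> {x. range x \<subseteq> A}"
      using closedin_subset[OF closed] unfolding topspace_full_shift .
    from subsetD[OF this that] show ?thesis by (auto intro: rangeI)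
  qed
  have top: "topspace ?T = X"
    using closedin_subset[OF closed] by (simp add: topspace_subtopology Int_absorb1)
  have "compact_space (full_shift A)"
    using assms(1) by (simp add: full_shift_def compact_space_product_topology compact_space_discrete_topology)
  then have compact: "compactin ?T X"
    using closed closedin_compact_space compactin_subtopology by blast
  have "\<exists>r. \<forall>y\<in>X. (\<forall>i. \<bar>i\<bar> \<le> int r \<longrightarrow> y i = x i) \<longrightarrow> \<phi> y 0 = \<phi> x 0" if x: "x \<in> X" for x
  proof -
    have "continuous_map (full_shift A) (discrete_topology A) (\<lambda>x. x 0)"
      unfolding full_shift_def by (rule continuous_map_product_projection) simp
    then have "continuous_map ?T (discrete_topology A) (\<lambda>x. x 0)"
      by (rule continuous_map_from_subtopology)
    from continuous_map_compose[OF shift_AutD(4)[OF assms(2,3)] this]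
    have "openin ?T {y \<in> topspace ?T. (\<lambda>x. \<phi> x 0) y \<in> {\<phi> x 0}}"
      using XA shift_AutD(1)[OF assms(2,3) x] by (intro openin_continuous_map_preimage) (auto simp: o_def)
    then obtain V where V: "openin (full_shift A) V" "{y \<in> X. \<phi> y 0 = \<phi> x 0} = V \<inter> X"
      unfolding top openin_subtopology by auto
    then have "x \<in> V" using x by blast
    then obtain W where W: "finite {i. W i \<noteq> A}" "x \<in> Pi\<^sub>E UNIV W" "Pi\<^sub>E UNIV W \<subseteq> V"
      using V(1) unfolding full_shift_def openin_product_topology_alt by auto
    define r where "r = Max (insert 0 ((\<lambda>i. nat \<bar>i\<bar>) ` {i. W i \<noteq> A}))"
    have r: "\<bar>i\<bar> \<le> int r" if "W i \<noteq> A" for i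
    proof -
      have "nat \<bar>i\<bar> \<le> r" unfolding r_def using W(1) that by (intro Max_ge) auto
      then show ?thesis by simp
    qed
    have "y \<in> V" if "y \<in> X" "\<forall>i. \<bar>i\<bar> \<le> int r \<longrightarrow> y i = x i" for y
    proof -
      have "y i \<in> W i" for i
        using W(2) that r[of i] XA[OF that(1), of i] by (cases "W i = A") (auto simp: PiE_iff)
      then have "y \<in> Pi\<^sub>E UNIV W" by (simp add: PiE_iff)
      then show ?thesis using W(3) by blast
    qed
    then show ?thesis using V(2) by blast
  qed
  then obtain r where r: "\<And>x y. \<lbrakk>x \<in> X; y \<in> X; \<forall>i. \<bar>i\<bar> \<le> int (r x) \<longrightarrow> y i = x i\<rbrakk> \<Longrightarrow> \<phi> y 0 = \<phi> x 0"
    by metis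
  define C where "C = (\<lambda>x. {y \<in> X. \<forall>i. \<bar>i\<bar> \<le> int (r x) \<longrightarrow> y i = x i})"
  have "openin ?T (C x)" if "x \<in> X" for x
  proof -
    \<comment> \<open>The cylinder is a box with finitely many restricted coordinates, hence open in
      the product topology.\<close>
    let ?W = "\<lambda>i. if \<bar>i\<bar> \<le> int (r x) then {x i} else A"
    have "finite {i. ?W i \<noteq> A}"
      by (rule finite_subset[of _ "{- int (r x)..int (r x)}"]) auto
    then have "openin (full_shift A) (Pi\<^sub>E UNIV ?W)"
      unfolding full_shift_def using XA[OF that] by (intro product_topology_basis) auto
    moreover have "C x = X \<inter> Pi\<^sub>E UNIV ?W"
      using XA by (auto simp: C_def PiE_iff split: if_splits)
    ultimately show ?thesis
      by (simp add: openin_subtopology_Int2)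
  qed
  moreover have "X \<subseteq> \<Union>(C ` X)" by (auto simp: C_def)
  ultimately obtain F where "finite F" "F \<subseteq> C ` X" "X \<subseteq> \<Union>F"
    using compactinD[OF compact, of "C ` X"] by auto
  then obtain J where J: "finite J" "J \<subseteq> X" "X \<subseteq> \<Union>(C ` J)"
    by (metis finite_subset_image)
  define R where "R = Max (insert 0 (r ` J))"
  have "has_range X \<phi> R"
    unfolding has_range_def
  proof (intro ballI impI)
    fix x y assume xy: "x \<in> X" "y \<in> X" and eq: "\<forall>i. \<bar>i\<bar> \<le> int R \<longrightarrow> x i = y i"
    obtain z where z: "z \<in> J" "x \<in> C z" using J(3) xy(1) by blast
    have "r z \<le> R" unfolding R_def using J(1) z(1) by (intro Max_ge) auto
    then have "y \<in> C z" using z(2) eq xy(2) by (auto simp: C_def)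
    then show "\<phi> x 0 = \<phi> y 0"
      using r[of z x] r[of z y] z J(2) by (auto simp: C_def)
  qed
  then show ?thesis ..
qed

lemma set_pow_has_range:
  assumes "subshift A X" "S \<subseteq> carrier (shift_Aut A X)" "\<And>\<phi>. \<phi> \<in> S \<Longrightarrow> has_range X \<phi> R"
    and "g \<in> set_pow (shift_Aut A X) S n"
  shows "g \<in> carrier (shift_Aut A X) \<and> has_range X g (n * R)"
  using assms(4)
proof (induction n arbitrary: g)
  case 0
  have "\<one>\<^bsub>shift_Aut A X\<^esub> \<in> carrier (shift_Aut A X)"
    using group_shift_Aut[OF assms(1)] by (simp add: group.is_monoid)
  moreover have "has_range X \<one>\<^bsub>shift_Aut A X\<^esub> 0"
    by (simp add: has_range_def shift_Aut_def BijGroup_def)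
  ultimately show ?case using 0 by simp
next
  case (Suc n)
  interpret group "shift_Aut A X" by (rule group_shift_Aut[OF assms(1)])
  obtain s h where sh: "s \<in> S" "h \<in> set_pow (shift_Aut A X) S n" "g = s \<otimes>\<^bsub>shift_Aut A X\<^esub> h"
    using Suc.prems by (auto simp: set_mult_def)
  have h: "h \<in> carrier (shift_Aut A X)" "has_range X h (n * R)" using Suc.IH[OF sh(2)] by auto
  have s: "s \<in> carrier (shift_Aut A X)" using sh(1) assms(2) by blast
  have "g = compose X s h"
    using sh(3) s h(1) by (auto simp: shift_Aut_def BijGroup_def)
  then show ?case
    using has_range_compose[OF assms(1) h(1) assms(3)[OF sh(1)] h(2)] m_closed[OF s h(1)] sh(3) by simp
qed

text \<open>The points of \<open>Q\<close> see every word of length \<open>m\<close>, so a map of range at most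
  \<open>(m - 1) / 2\<close> is determined by its values on \<open>Q\<close>.\<close>

lemma card_set_pow_le:
  assumes "finite A" "subshift A X" "S \<subseteq> carrier (shift_Aut A X)"
    and range: "\<And>\<phi>. \<phi> \<in> S \<Longrightarrow> has_range X \<phi> R"
    and "2 * (n * R) < m" and Q: "Q \<subseteq> X" "finite Q"
    and cover: "\<And>y. y \<in> X \<Longrightarrow> \<exists>x\<in>Q. \<exists>t\<le>p. word y 0 m = word x (int t) m"
  shows "card (set_pow (shift_Aut A X) S n) \<le> complexity X (m + p) ^ card Q"
proof -
  define r where "r = n * R"
  let ?B = "set_pow (shift_Aut A X) S n"
  let ?D = "Q \<rightarrow>\<^sub>E language X (m + p)"
  have B: "g \<in> carrier (shift_Aut A X)" "has_range X g r" if "g \<in> ?B" for g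
    using set_pow_has_range[OF assms(2,3) range that] by (auto simp: r_def)
  have "inj_on (\<lambda>g. \<lambda>x\<in>Q. word (g x) 0 (m + p)) ?B"
  proof (rule inj_onI)
    fix g h assume gh: "g \<in> ?B" "h \<in> ?B"
      and eq: "(\<lambda>x\<in>Q. word (g x) 0 (m + p)) = (\<lambda>x\<in>Q. word (h x) 0 (m + p))"
    have eq': "g x (int i) = h x (int i)" if "x \<in> Q" "i < m + p" for x i
      using fun_cong[OF eq, of x] that by (auto simp: word_eq_iff)
    show "g = h"
    proof (rule extensionalityI[of g X h])
      fix y assume y: "y \<in> X"
      show "g y = h y"
      proof
        fix j
        \<comment> \<open>The word from \<open>j - r\<close> of length \<open>m > 2 * r\<close>
          contains the window determining coordinate \<open>j\<close> of the image. In
          \<open>x\<close> this window is centred at \<open>t + r\<close>, below the recorded length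
          \<open>m + p\<close>.\<close>
        obtain x t where xt: "x \<in> Q" "t \<le> p" "word (translate (j - int r) y) 0 m = word x (int t) m"
          using cover[of "translate (j - int r) y"] y translate_in_iff[OF assms(2)] by blast
        have "y (j + i) = x (int (t + r) + i)" if "\<bar>i\<bar> \<le> int r" for i
        proof -
          have "0 \<le> i + int r" "nat (i + int r) < m"
            using that assms(5) unfolding r_def[symmetric] by linarith+
          then show ?thesis
            using xt(3)[unfolded word_translate word_eq_iff, rule_format, of "nat (i + int r)"]
            by (simp add: algebra_simps)
        qed
        then have "f y j = f x (int (t + r))" if "f \<in> ?B" for f
          using has_range_at[OF assms(2) B[OF that] y] xt(1) Q(1) by blast
        moreover have "t + r < m + p" using xt(2) assms(5) by (simp add: r_def)
        ultimately show "g y j = h y j"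
          using gh eq'[OF xt(1)] by metis
      qed
    qed (use gh B shift_AutD(2)[OF assms(2)] in auto)
  qed
  moreover have "g x \<in> X" if "g \<in> ?B" "x \<in> Q" for g x
    using shift_AutD(1)[OF assms(2) B(1)[OF that(1)]] that(2) Q(1) by blast
  then have "(\<lambda>g. \<lambda>x\<in>Q. word (g x) 0 (m + p)) ` ?B \<subseteq> ?D"
    by (auto intro!: word_in_language[OF assms(2)])
  moreover have "finite ?D"
    using Q(2) finite_language[OF assms(1,2)] by (intro finite_PiE) auto
  ultimately have "card ?B \<le> card ?D" by (rule card_inj_on_le)
  then show ?thesis
    using Q(2) by (simp add: card_PiE complexity_def)
qed

section \<open>Asymptotics\<close>

text \<open>The terms grow almost geometrically, so a partial sum is comparable to the bound for its
  last term. The finitely many early terms form a constant that \<open>2 ^ J / (J + 1)\<close>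
  absorbs.\<close>

lemma dyadic_sum_bound:
  fixes f :: "nat \<Rightarrow> real"
  assumes f: "\<And>d. d > 0 \<Longrightarrow> \<forall>\<^sub>F j in sequentially. f j * real (j + 1) \<le> d * 2 ^ j" and "d > 0"
  shows "\<forall>\<^sub>F J in sequentially. (\<Sum>j<J. f j) * real (J + 1) \<le> d * 2 ^ J"
proof -
  define d' where "d' = d / 4"
  have "d' > 0" using \<open>d > 0\<close> by (simp add: d'_def)
  obtain j0 where j0: "\<And>j. j \<ge> j0 \<Longrightarrow> f j * real (j + 1) \<le> d' * 2 ^ j"
    using f[OF \<open>d' > 0\<close>] by (auto simp: eventually_sequentially)
  \<comment> \<open>The induction step needs \<open>4 * (J + 2) \<le> 6 * (J + 1)\<close>, hence
    \<open>J \<ge> 1\<close>.\<close>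
  define j1 where "j1 = max 1 j0"
  define C where "C = (\<Sum>j<j1. f j)"
  have bound: "(\<Sum>j<J. f j) \<le> C + 3 * d' * 2 ^ J / real (J + 1)" if "J \<ge> j1" for J
    using that
  proof (induction J rule: dec_induct)
    case base
    then show ?case using \<open>d' > 0\<close> by (simp add: C_def)
  next
    case (step J)
    define a where "a = d' * 2 ^ J / real (J + 1)"
    have "f J \<le> a"
      unfolding a_def using j0[of J] step(1) by (simp add: j1_def pos_le_divide_eq)
    moreover have "4 * d' * 2 ^ J / real (J + 1) \<le> 3 * d' * 2 ^ Suc J / real (Suc J + 1)"
    proof -
      have "4 * d' * 2 ^ J * real (J + 2) \<le> (6 * d' * 2 ^ J) * real (J + 1)"
      proof -
        have "d' * 2 ^ J * (4 * real (J + 2)) \<le> d' * 2 ^ J * (6 * real (J + 1))"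
          using step(1) \<open>d' > 0\<close> by (intro mult_left_mono) (auto simp: j1_def)
        then show ?thesis by (simp only: mult_ac)
      qed
      then show ?thesis
        by (simp add: divide_simps)
    qed
    moreover have "3 * d' * 2 ^ J / real (J + 1) = 3 * a" "4 * d' * 2 ^ J / real (J + 1) = 4 * a"
      by (simp_all add: a_def)
    ultimately show ?case
      using step.IH unfolding sum.lessThan_Suc by linarith
  qed
  have "(\<lambda>J. C * (real J + 1) / 2 ^ J) \<longlonglongrightarrow> 0"
    by real_asymp
  then have "\<forall>\<^sub>F J in sequentially. C * (real J + 1) / 2 ^ J < d'"
    using \<open>d' > 0\<close> by (rule order_tendstoD)
  then show ?thesis
    using eventually_ge_at_top[of j1]
  proof eventually_elim
    case (elim J)
    have "(\<Sum>j<J. f j) * real (J + 1) \<le> (C + 3 * d' * 2 ^ J / real (J + 1)) * real (J + 1)"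
      using bound[OF elim(2)] by (intro mult_right_mono) auto
    also have "\<dots> = C * (real J + 1) + 3 * d' * 2 ^ J"
      by (simp add: field_simps)
    also have "\<dots> \<le> d' * 2 ^ J + 3 * d' * 2 ^ J"
      using elim(1) by (simp add: field_simps)
    finally show ?case by (simp add: d'_def)
  qed
qed

text \<open>The \<open>m\<close> increments over \<open>[m, 2 * m)\<close> telescope to at most
  \<open>P (2 * m)\<close>, so one of them is at most the average.\<close>

lemma small_increment:
  fixes P :: "nat \<Rightarrow> nat"
  assumes "mono P" "m > 0"
  obtains M where "m \<le> M" "M < 2 * m" "m * (P (Suc M) - P M) \<le> P (2 * m)"
proof (rule ccontr)
  note small = that
  assume "\<not> thesis"
  then have big: "Suc (P (2 * m)) \<le> m * (P (Suc M) - P M)" if "m \<le> M" "M < 2 * m" for M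
    using small[OF that] not_less_eq_eq by blast
  have "k * Suc (P (2 * m)) \<le> m * (P (m + k) - P m)" if "k \<le> m" for k
    using that
  proof (induction k)
    case (Suc k)
    have "Suc k * Suc (P (2 * m)) \<le> m * (P (Suc (m + k)) - P (m + k)) + m * (P (m + k) - P m)"
      unfolding mult_Suc using Suc big[of "m + k"] by (intro add_mono) auto
    also have "\<dots> = m * (P (Suc (m + k)) - P m)"
      using monoD[OF assms(1), of "m + k" "Suc (m + k)"] monoD[OF assms(1), of m "m + k"]
      by (simp add: distrib_left[symmetric])
    finally show ?case by simp
  qed simp
  from this[of m] have "m * Suc (P (2 * m)) \<le> m * (P (2 * m) - P m)"
    by (simp add: mult_2)
  then have "Suc (P (2 * m)) \<le> P (2 * m) - P m"
    using \<open>m > 0\<close> by (metis mult_le_cancel1)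
  then show False by linarith
qed

text \<open>The right special, short-cycle and long-cycle parts of \<open>q * ln M\<close> are at most \<open>8\<close>, \<open>1\<close> and \<open>2\<close>
  times \<open>d * M\<close>, while \<open>ln (P (M + P M)) \<le> 5 * ln M\<close>; hence the choice of \<open>d\<close>.\<close>

lemma growth_estimate:
  fixes P :: "nat \<Rightarrow> nat" and e :: real and R :: nat
  assumes mono: "mono P" and lim: "\<And>d. d > 0 \<Longrightarrow> \<forall>\<^sub>F n in sequentially. real (P n) * ln (real n) \<le> d * real n ^ 2"
    and "e > 0" "R > 0"
  obtains n M J where "2 * (n * R) < M" "M > 0"
    "\<And>q. q + 2 * P M \<le> 2 * P (Suc M) + ((\<Sum>j<J. P (2 ^ (j + 2)) div 2 ^ j) + P M div 2 ^ J) \<Longrightarrow>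
      real (P (M + P M)) ^ q < (1 + e) ^ n"
proof -
  define c where "c = ln (1 + e)"
  \<comment> \<open>The factor 60 exceeds \<open>5 * 11\<close>, and \<open>4 * R\<close> comes from
    \<open>M \<le> 4 * R * n\<close>. The cap 1 yields \<open>P n \<le> n ^ 2\<close> for
    \<open>n \<ge> M\<close>.\<close>
  define d where "d = min 1 (c / (240 * real R))"
  have "c > 0" using \<open>e > 0\<close> by (simp add: c_def)
  then have d: "d > 0" "d \<le> 1" "d * 240 * real R \<le> c"
    using \<open>R > 0\<close> by (auto simp: d_def min_def field_simps)
  define f where "f = (\<lambda>j. real (P (2 ^ (j + 2)) div 2 ^ j))"
  have dyadic: "\<forall>\<^sub>F J in sequentially. (\<Sum>j<J. f j) * real (J + 1) \<le> d * 2 ^ J"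
  proof (rule dyadic_sum_bound[OF _ d(1)])
    fix d :: real assume "d > 0"
    have "filterlim (\<lambda>j::nat. 2 ^ (j + 2) :: nat) at_top sequentially"
      by (intro filterlim_subseq strict_monoI power_strict_increasing) auto
    \<comment> \<open>The 32 cancels the factor 16 in \<open>(2 ^ (j + 2)) ^ 2\<close> and the
      factor 2 between \<open>j + 1\<close> and the logarithm.\<close>
    from eventually_compose_filterlim[OF lim[of "d / 32"] this] \<open>d > 0\<close>
    have "\<forall>\<^sub>F j in sequentially. real (P (2 ^ (j + 2))) * ln (2 ^ (j + 2)) \<le> d / 32 * (2 ^ (j + 2)) ^ 2"
      by simp
    then show "\<forall>\<^sub>F j in sequentially. f j * real (j + 1) \<le> d * 2 ^ j"
    proof eventually_elim
      case (elim j)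
      have "real (j + 1) \<le> 2 * ln (2 ^ (j + 2))"
      proof -
        have "real (j + 1) \<le> 2 * (real (j + 2) * (1 / 2))" by simp
        also have "\<dots> \<le> 2 * (real (j + 2) * ln 2)"
          using ln2_ge_two_thirds by (intro mult_left_mono) auto
        also have "real (j + 2) * ln 2 = ln ((2::real) ^ (j + 2))"
          by (rule ln_realpow[symmetric])
        finally show ?thesis .
      qed
      then have "real (P (2 ^ (j + 2))) * real (j + 1) \<le> real (P (2 ^ (j + 2))) * (2 * ln (2 ^ (j + 2)))"
        by (rule mult_left_mono) simp
      also have "\<dots> \<le> 2 * (d / 32 * (2 ^ (j + 2)) ^ 2)"
        using elim by simp
      also have "\<dots> = d * 2 ^ j * 2 ^ j"
        by (simp add: power_add power2_eq_square)
      finally have "real (P (2 ^ (j + 2))) / 2 ^ j * real (j + 1) \<le> d * 2 ^ j"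
        by (simp add: field_simps)
      moreover have "f j \<le> real (P (2 ^ (j + 2))) / 2 ^ j"
        using of_nat_div_le_of_nat[of "P (2 ^ (j + 2))" "2 ^ j", where ?'a = real] by (simp add: f_def)
      then have "f j * real (j + 1) \<le> real (P (2 ^ (j + 2))) / 2 ^ j * real (j + 1)"
        by (rule mult_right_mono) simp
      ultimately show ?case by linarith
    qed
  qed
  obtain J0 where J0: "\<And>J. J \<ge> J0 \<Longrightarrow> (\<Sum>j<J. f j) * real (J + 1) \<le> d * 2 ^ J"
    using dyadic by (auto simp: eventually_sequentially)
  obtain N where N: "\<And>n. n \<ge> N \<Longrightarrow> real (P n) * ln (real n) \<le> d * real n ^ 2"
    using lim[OF d(1)] by (auto simp: eventually_sequentially)
  \<comment> \<open>The summands ensure in turn the bound on \<open>P\<close>,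
    \<open>J \<ge> J0\<close>, room to compare \<open>M\<close> with \<open>n\<close>, and
    \<open>ln M \<ge> 1\<close>.\<close>
  define m where "m = N + 2 ^ J0 + 4 * R + 4"
  have "m > 0" by (simp add: m_def)
  obtain M where M: "m \<le> M" "M < 2 * m" "m * (P (Suc M) - P M) \<le> P (2 * m)"
    using small_increment[OF mono \<open>m > 0\<close>] by blast
  have M4: "M \<ge> 4" "N \<le> M" "2 ^ J0 \<le> M" "4 * R + 4 \<le> M" using M(1) by (auto simp: m_def)
  have lnM: "ln (real M) \<ge> 1"
  proof -
    have "exp 1 \<le> real M" using exp_le M4(1) by linarith
    then show ?thesis using M4(1) by (subst ln_ge_iff) auto
  qed
  \<comment> \<open>Separating short from long cycles at a period comparable to \<open>M\<close>
    makes both contributions of order \<open>d * M / ln M\<close>.\<close>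
  obtain J where J: "2 ^ J \<le> M" "M < 2 ^ (J + 1)"
    using ex_power_ivl1[of 2 M] M4(1) by auto
  have "(2::nat) ^ J0 < 2 ^ (J + 1)" using J(2) M4(3) by linarith
  then have "J0 < J + 1" by (rule power_less_imp_less_exp[rotated]) simp
  then have "J0 \<le> J" by simp
  have lnM_J: "ln (real M) \<le> real (J + 1)"
  proof -
    have "ln (real M) \<le> ln (real (2 ^ (J + 1)))"
      using J(2) M4(1) by (subst ln_le_cancel_iff) linarith+
    also have "\<dots> = real (J + 1) * ln 2"
      unfolding of_nat_power of_nat_numeral by (rule ln_realpow)
    also have "\<dots> \<le> real (J + 1)" using ln_2_less_1 by (simp add: mult_left_le)
    finally show ?thesis .
  qed
  have f_nonneg: "(\<Sum>j<J. f j) \<ge> 0" by (intro sum_nonneg) (simp add: f_def)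
  have 1: "real (P (Suc M) - P M) * ln (real M) \<le> 4 * d * real M"
  proof -
    have "real (P (Suc M) - P M) * ln (real M) * real m \<le> real (P (2 * m)) * ln (real M)"
      using M(3) lnM by (simp flip: of_nat_mult add: mult_ac mult_right_mono)
    also have "\<dots> \<le> real (P (2 * m)) * ln (real (2 * m))"
      using M(2) M4(1) by (intro mult_left_mono) auto
    also have "\<dots> \<le> d * real (2 * m) ^ 2"
      by (rule N) (simp add: m_def)
    also have "\<dots> = (4 * d * real m) * real m"
      by (simp add: power2_eq_square)
    finally have "real (P (Suc M) - P M) * ln (real M) \<le> 4 * d * real m"
      using \<open>m > 0\<close> by simp
    also have "\<dots> \<le> 4 * d * real M" using M(1) d(1) by simp
    finally show ?thesis .
  qed
  have 2: "(\<Sum>j<J. f j) * ln (real M) \<le> d * real M"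
  proof -
    have "(\<Sum>j<J. f j) * ln (real M) \<le> (\<Sum>j<J. f j) * real (J + 1)"
      using lnM_J f_nonneg by (rule mult_left_mono)
    also have "\<dots> \<le> d * 2 ^ J" by (rule J0[OF \<open>J0 \<le> J\<close>])
    also have "\<dots> \<le> d * real M"
    proof (rule mult_left_mono)
      show "2 ^ J \<le> real M" using J(1) by (metis of_nat_le_iff of_nat_numeral of_nat_power)
    qed (use d in simp)
    finally show ?thesis .
  qed
  have 3: "real (P M div 2 ^ J) * ln (real M) \<le> 2 * d * real M"
  proof -
    have "real M \<le> 2 * 2 ^ J" using J(2)
      by (metis less_imp_le of_nat_le_iff of_nat_numeral of_nat_power power_add power_one_right mult.commute)
    have "real (P M div 2 ^ J) * ln (real M) \<le> real (P M) / 2 ^ J * ln (real M)"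
      using of_nat_div_le_of_nat[of "P M" "2 ^ J", where ?'a = real] lnM by (intro mult_right_mono) auto
    also have "\<dots> \<le> d * real M ^ 2 / 2 ^ J"
      using N[OF M4(2)] by (simp add: divide_right_mono)
    also have "\<dots> = d * real M * real M / 2 ^ J"
      by (simp add: power2_eq_square)
    also have "\<dots> \<le> d * real M * (2 * 2 ^ J) / 2 ^ J"
      using \<open>real M \<le> 2 * 2 ^ J\<close> d(1) by (intro divide_right_mono mult_left_mono) auto
    also have "\<dots> = 2 * d * real M" by simp
    finally show ?thesis .
  qed
  have P_sq: "real (P n) \<le> real n ^ 2" if "n \<ge> M" for n
  proof -
    have "ln (real n) \<ge> ln (real M)" using that M4(1) by simp
    then have "real (P n) * 1 \<le> real (P n) * ln (real n)" using lnM by (intro mult_left_mono) auto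
    also have "\<dots> \<le> d * real n ^ 2" using that M4(2) by (intro N) simp
    also have "\<dots> \<le> 1 * real n ^ 2" using d(2) by (intro mult_right_mono) auto
    finally show ?thesis by simp
  qed
  have P_poly: "real (P (M + P M)) \<le> real M ^ 5"
  proof -
    have "real (P (M + P M)) \<le> real (M + P M) ^ 2" by (rule P_sq) simp
    also have "\<dots> \<le> (2 * real M ^ 2) ^ 2"
    proof (rule power_mono)
      have "real M \<le> real M ^ 2" using M4(1) by (simp add: power2_eq_square)
      then show "real (M + P M) \<le> 2 * real M ^ 2" using P_sq[OF order_refl] unfolding of_nat_add by linarith
    qed simp
    also have "\<dots> = 4 * real M ^ 4" by (simp add: power_mult_distrib flip: power_mult)
    also have "\<dots> \<le> real M * real M ^ 4" using M4(1) by (intro mult_right_mono) auto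
    finally show ?thesis by (simp flip: power_Suc)
  qed
  \<comment> \<open>The largest number of factors whose total range fits into words of length
    \<open>M\<close>; it is proportional to \<open>M\<close>.\<close>
  define n where "n = (M - 1) div (2 * R)"
  have "n * (2 * R) \<le> M - 1" by (simp add: n_def)
  then have nR: "2 * (n * R) < M" using M4(1) by (simp add: mult_ac)
  have n: "real M \<le> 4 * real R * real n"
  proof -
    have "M - 1 < n * (2 * R) + 2 * R"
      using div_mult_mod_eq[of "M - 1" "2 * R"] mod_less_divisor[of "2 * R" "M - 1"] \<open>R > 0\<close>
      unfolding n_def by linarith
    then have "2 * M \<le> n * (4 * R) + 4 * R + 2" by (simp add: algebra_simps)
    then have "M \<le> 4 * R * n" using M4(4) by (simp add: algebra_simps)
    then show ?thesis by (metis of_nat_le_iff of_nat_mult of_nat_numeral)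
  qed
  have bound: "real (P (M + P M)) ^ q < (1 + e) ^ n"
    if q: "q + 2 * P M \<le> 2 * P (Suc M) + ((\<Sum>j<J. P (2 ^ (j + 2)) div 2 ^ j) + P M div 2 ^ J)" for q
  proof -
    have "q \<le> 2 * (P (Suc M) - P M) + (\<Sum>j<J. P (2 ^ (j + 2)) div 2 ^ j) + P M div 2 ^ J"
      using q monoD[OF mono, of M "Suc M"] by simp
    then have "real q \<le> real (2 * (P (Suc M) - P M) + (\<Sum>j<J. P (2 ^ (j + 2)) div 2 ^ j) + P M div 2 ^ J)"
      by (simp only: of_nat_le_iff)
    also have "\<dots> = 2 * real (P (Suc M) - P M) + (\<Sum>j<J. f j) + real (P M div 2 ^ J)"
      by (simp only: f_def of_nat_add of_nat_mult of_nat_sum of_nat_numeral)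
    finally have "real q * ln (real M) \<le>
        (2 * real (P (Suc M) - P M) + (\<Sum>j<J. f j) + real (P M div 2 ^ J)) * ln (real M)"
      using lnM by (intro mult_right_mono) auto
    also have "\<dots> \<le> 11 * (d * real M)"
      using 1 2 3 by (simp only: distrib_right)
    finally have qM: "real q * ln (real M) \<le> 11 * (d * real M)" .
    have "real (P (M + P M)) ^ q \<le> (real M ^ 5) ^ q"
      using P_poly by (rule power_mono) simp
    also have "\<dots> = exp (5 * (real q * ln (real M)))"
    proof -
      have "(real M ^ 5) ^ q = exp (ln (real M)) ^ (5 * q)"
        using M4(1) by (simp add: power_mult)
      also have "\<dots> = exp (5 * (real q * ln (real M)))"
        by (simp flip: exp_of_nat_mult add: mult_ac)
      finally show ?thesis .
    qed
    also have "\<dots> < exp (real n * c)"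
    proof -
      have "5 * (real q * ln (real M)) \<le> 55 * (d * real M)" using qM by simp
      also have "\<dots> < 60 * (d * real M)" using d(1) M4(1) by simp
      also have "\<dots> \<le> 60 * (d * (4 * real R * real n))"
        using n d(1) by simp
      also have "\<dots> = (d * 240 * real R) * real n" by simp
      also have "\<dots> \<le> c * real n" using d(3) by (rule mult_right_mono) simp
      finally show ?thesis by (simp add: mult.commute)
    qed
    also have "\<dots> = (1 + e) ^ n"
      using \<open>e > 0\<close> by (simp add: exp_of_nat_mult c_def)
    finally show ?thesis .
  qed
  have "M > 0" using M4(1) by simp
  from that[OF nR this bound] show ?thesis .
qed

theorem theorem1:
  fixes A :: "'a set" and X :: "(int \<Rightarrow> 'a) set"
  assumes "finite A"
    and "subshift A X"
    and "(\<lambda>n. real (complexity X n)) \<in> o(\<lambda>n. real n ^ 2 / ln (real n) ^ 2)"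
  shows "amenable (shift_Aut A X)"
proof (rule amenable_if_subexponential_growth[OF group_shift_Aut[OF assms(2)]])
  fix S and e :: real
  assume S: "finite S" "S \<subseteq> carrier (shift_Aut A X)" and "e > 0"
  have "\<forall>\<phi>\<in>S. \<exists>r. has_range X \<phi> r"
    using Curtis_Hedlund_Lyndon[OF assms(1,2)] S(2) by blast
  then obtain r where r: "\<And>\<phi>. \<phi> \<in> S \<Longrightarrow> has_range X \<phi> (r \<phi>)" by metis
  \<comment> \<open>The successor makes the common range positive, as the growth estimate divides by
    it.\<close>
  define R where "R = Suc (Max (insert 0 (r ` S)))"
  have R: "has_range X \<phi> R" if "\<phi> \<in> S" for \<phi>
  proof (rule has_range_mono[OF r[OF that]])
    show "r \<phi> \<le> R" unfolding R_def using S(1) that by (intro le_SucI Max_ge) auto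
  qed
  have mono: "mono (complexity X)"
    using complexity_mono[OF assms(1,2)] by (auto intro: monoI)
  have lim: "\<forall>\<^sub>F n in sequentially. real (complexity X n) * ln (real n) \<le> d * real n ^ 2" if "d > 0" for d
    using landau_o.smallD[OF assms(3) that] eventually_ge_at_top[of 3]
  proof eventually_elim
    case (elim n)
    \<comment> \<open>A logarithm of at least 1 allows the remaining factor in the denominator to be
      dropped.\<close>
    have "exp 1 \<le> real n" using exp_le elim(2) by linarith
    then have ln: "ln (real n) \<ge> 1" using elim(2) by (subst ln_ge_iff) auto
    have "real (complexity X n) * ln (real n) \<le> d * (real n ^ 2 / ln (real n) ^ 2) * ln (real n)"
      using elim(1) ln by (intro mult_right_mono) auto
    also have "\<dots> = d * real n ^ 2 / ln (real n)"
      using ln by (simp add: power2_eq_square)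
    also have "\<dots> \<le> d * real n ^ 2 / 1"
      using ln \<open>d > 0\<close> by (intro divide_left_mono) auto
    finally show ?case by simp
  qed
  have "R > 0" by (simp add: R_def)
  obtain n M J where nMJ: "2 * (n * R) < M" "M > 0"
    "\<And>q. q + 2 * complexity X M \<le> 2 * complexity X (Suc M) +
        ((\<Sum>j<J. complexity X (2 ^ (j + 2)) div 2 ^ j) + complexity X M div 2 ^ J) \<Longrightarrow>
      real (complexity X (M + complexity X M)) ^ q < (1 + e) ^ n"
    using growth_estimate[OF mono lim \<open>e > 0\<close> \<open>R > 0\<close>] by blast
  obtain Q where Q: "Q \<subseteq> X" "finite Q"
    "card Q + 2 * complexity X M \<le> 2 * complexity X (Suc M) +
      ((\<Sum>j<J. complexity X (2 ^ (j + 2)) div 2 ^ j) + complexity X M div 2 ^ J)"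
    "\<And>y. y \<in> X \<Longrightarrow> \<exists>x\<in>Q. \<exists>t\<le>complexity X M. word y 0 M = word x (int t) M"
    using covering_points[OF assms(1,2) nMJ(2)] by blast
  have "real (card (set_pow (shift_Aut A X) S n)) \<le> real (complexity X (M + complexity X M) ^ card Q)"
    using card_set_pow_le[OF assms(1,2) S(2) R nMJ(1) Q(1,2,4)] by simp
  also have "\<dots> < (1 + e) ^ n"
    using nMJ(3)[OF Q(3)] by simp
  finally show "\<exists>n. real (card (set_pow (shift_Aut A X) S n)) < (1 + e) ^ n" by blast
qed

end
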